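(* For all sufficiently large $n$ there is a graph $G$ on $\Theta(n)$ vertices, all of whose vertex degrees lie in the range $[\sqrt{n},\sqrt{n}\log^3 n]$, such that for $n$ i.i.d. uniform arrivals from $E(G)$: the Greedy algorithm, even with uniformly random tie-breaking, has maximum load $\Omega(\log n/\log\log n)$ (with high probability), while the expected offline optimum satisfies $\mathrm{OPT}(G,n)=O(\log\log n)$.
   Context: Online graph balancing with i.i.d. arrivals: given a base graph $G=(V,E)$, at each step $t=1,\dots,T$ an edge $e_t$ is drawn independently and uniformly at random from $E$ (with replacement) and must be irrevocably oriented towards one of its endpoints upon arrival; the load of a vertex is the number of edges oriented into it. The Greedy algorithm orients each arriving edge towards the endpoint with currently smaller load, breaking ties uniformly at random. $\mathrm{OPT}(G,T)$ denotes the expectation, over the random sample $e_1,\dots,e_T$, of the minimum over all orientations of these sampled edges of the maximum vertex load. *)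

theory Defs
  imports "HOL-Probability.Probability" "HOL-Library.Landau_Symbols"
begin

definition simple_graph :: "'a set \<Rightarrow> 'a set set \<Rightarrow> bool" where
  "simple_graph V E \<longleftrightarrow> finite V \<and> (\<forall>e\<in>E. e \<subseteq> V \<and> card e = 2)"

definition vertex_degree :: "'a set set \<Rightarrow> 'a \<Rightarrow> nat" where
  "vertex_degree E v = card {e \<in> E. v \<in> e}"

text \<open>
  An arrival sequence is a list of edges, earliest arrival first. An orientation of it is the list
  of the heads chosen for the successive arrivals, so that repeated arrivals of the same edge may be
  oriented differently.
\<close>

definition orientations :: "'a set list \<Rightarrow> 'a list set" where
  "orientations es = {hs. list_all2 (\<in>) hs es}"

definition load :: "'a list \<Rightarrow> 'a \<Rightarrow> nat" where
  "load hs v = count_list hs v"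

definition max_load :: "'a set \<Rightarrow> 'a list \<Rightarrow> nat" where
  "max_load V hs = Max (load hs ` V)"

definition iid_arrivals :: "'a set set \<Rightarrow> nat \<Rightarrow> 'a set list pmf" where
  "iid_arrivals E T = replicate_pmf T (pmf_of_set E)"

definition least_loaded :: "'a list \<Rightarrow> 'a set \<Rightarrow> 'a set" where
  "least_loaded hs e = {v \<in> e. \<forall>u\<in>e. load hs v \<le> load hs u}"

text \<open>
  The first argument of \<open>greedy\<close> holds the heads chosen so far. The tie-breaking choices
  at different arrivals are independent of each other and of the arrival sequence.
\<close>

primrec greedy :: "'a list \<Rightarrow> 'a set list \<Rightarrow> 'a list pmf" where
  "greedy hs [] = return_pmf hs"
| "greedy hs (e # es) =
     bind_pmf (pmf_of_set (least_loaded hs e)) (\<lambda>v. greedy (hs @ [v]) es)"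

definition greedy_max_load :: "'a set \<Rightarrow> 'a set set \<Rightarrow> nat \<Rightarrow> nat pmf" where
  "greedy_max_load V E T = map_pmf (max_load V) (bind_pmf (iid_arrivals E T) (greedy []))"

definition opt_max_load :: "'a set \<Rightarrow> 'a set list \<Rightarrow> nat" where
  "opt_max_load V es = Min (max_load V ` orientations es)"

definition OPT :: "'a set \<Rightarrow> 'a set set \<Rightarrow> nat \<Rightarrow> real" where
  "OPT V E T = measure_pmf.expectation (iid_arrivals E T) (\<lambda>es. real (opt_max_load V es))"

end

theory Submission
  imports Defs "HOL-Real_Asymp.Real_Asymp"
begin

text \<open>
  The graph is the blow-up of an \<open>r\<close>-ary tree on about \<open>sqrt n\<close> nodes: every node becomes an
  independent set (a cluster) of about \<open>sqrt n\<close> vertices and every tree edge a complete bipartite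
  graph, where \<open>r\<close> is of order \<open>ln n ^ 2\<close>.

  Greedy: cut the arrivals into \<open>L\<close> windows, with \<open>L\<close> of order \<open>ln n / ln (ln n)\<close>. If at the start of a
  window all vertices of the child clusters have load at least \<open>i\<close>, then an edge between a vertex \<open>v\<close>
  of load at most \<open>i\<close> and one of its children goes to \<open>v\<close> with probability at least one half. As
  \<open>v\<close> receives far more than \<open>ln n\<close> such edges in one window, its load exceeds \<open>i\<close> at the end of
  it. So the load grows by one per window while moving up one level of the tree.

  Optimum: treat each star (a cluster with its child clusters) separately. If the sampled edges of a
  star cannot be peeled by repeatedly removing a vertex of degree at most \<open>k\<close>, they contain a core
  with more than \<open>k * m\<close> edges between at most \<open>m\<close> children and at most \<open>m\<close> parents, for some
  \<open>m\<close>. A first-moment bound excludes this for \<open>k\<close> of order \<open>ln (ln n)\<close>, except with probability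
  polynomially small in \<open>n\<close>. Every vertex lies in at most two stars.
\<close>

section \<open>Probability mass functions and orientations\<close>

lemma prob_bind_pmf:
  "measure_pmf.prob (bind_pmf M f) A = measure_pmf.expectation M (\<lambda>x. measure_pmf.prob (f x) A)"
proof -
  have "ennreal (measure_pmf.prob (bind_pmf M f) A) = (\<integral>\<^sup>+x. ennreal (measure_pmf.prob (f x) A) \<partial>M)"
    by (simp flip: measure_pmf.emeasure_eq_measure)
  then show ?thesis
    by (subst integral_eq_nn_integral) (auto simp: enn2real_ennreal simp flip: \<open>ennreal _ = _\<close>)
qed

lemma integrable_pmf_indicator [simp]: "integrable (measure_pmf M) (indicator A :: _ \<Rightarrow> real)"
  by (rule measure_pmf.integrable_const_bound[where B = 1]) auto

lemma expectation_pmf_mono: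
  fixes f g :: "'a \<Rightarrow> real"
  assumes "\<And>x. x \<in> set_pmf M \<Longrightarrow> 0 \<le> f x" "\<And>x. x \<in> set_pmf M \<Longrightarrow> f x \<le> g x"
    and "\<And>x. x \<in> set_pmf M \<Longrightarrow> g x \<le> B"
  shows "measure_pmf.expectation M f \<le> measure_pmf.expectation M g"
proof (rule integral_mono_AE)
  have "\<bar>f x\<bar> \<le> B" "\<bar>g x\<bar> \<le> B" if "x \<in> set_pmf M" for x
    using assms[OF that] by auto
  then show "integrable M f" "integrable M g"
    by (auto intro!: measure_pmf.integrable_const_bound[where B = B] simp: AE_measure_pmf_iff)
  show "AE x in M. f x \<le> g x"
    using assms(2) by (simp add: AE_measure_pmf_iff)
qed

text \<open>Off the exceptional set \<open>B\<close> the conditional probability is at most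
  \<open>c\<close>, and on \<open>B\<close> it is at most 1. This separates the failure of earlier
  windows from that of the current one.\<close>

lemma prob_bind_pmf_le:
  assumes "\<And>x. x \<in> set_pmf M \<Longrightarrow> x \<notin> B \<Longrightarrow> measure_pmf.prob (f x) A \<le> c"
    and "0 \<le> c"
  shows "measure_pmf.prob (bind_pmf M f) A \<le> measure_pmf.prob M B + c"
proof -
  have "measure_pmf.expectation M (\<lambda>x. measure_pmf.prob (f x) A)
      \<le> measure_pmf.expectation M (\<lambda>x. indicator B x + c)"
  proof (rule expectation_pmf_mono[where B = "1 + c"])
    fix x assume x: "x \<in> set_pmf M"
    show "measure_pmf.prob (f x) A \<le> indicator B x + c"
    proof (cases "x \<in> B")
      case True
      then have "indicator B x + c = 1 + c" by simp
      with assms(2) measure_pmf.prob_le_1[of "f x" A] show ?thesis by linarith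
    next
      case False
      with assms(1)[OF x] show ?thesis by simp
    qed
    show "indicator B x + c \<le> 1 + c"
      by (simp add: indicator_def)
  qed simp
  also have "\<dots> = measure_pmf.prob M B + c"
    by (subst Bochner_Integration.integral_add) auto
  finally show ?thesis
    by (simp add: prob_bind_pmf)
qed

section \<open>Tail and binomial estimates\<close>

text \<open>This is the union bound over the \<open>t\<close>-subsets of positions that all hit
  \<open>F\<close>. The induction conditions on the first draw, and Pascal's rule adds up the two
  cases.\<close>

lemma replicate_pmf_count_ge:
  fixes p :: "'a pmf" and F :: "'a set"
  defines "q \<equiv> measure_pmf.prob p F"
  shows "measure_pmf.prob (replicate_pmf n p) {xs. t \<le> length (filter (\<lambda>x. x \<in> F) xs)}
           \<le> real (n choose t) * q ^ t"
proof (induction n arbitrary: t)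
  case 0
  show ?case by (cases t) auto
next
  case (Suc n)
  show ?case
  proof (cases t)
    case 0
    then show ?thesis by simp
  next
    case (Suc s)
    let ?R = "replicate_pmf n p"
    let ?P = "\<lambda>t. measure_pmf.prob ?R {xs. t \<le> length (filter (\<lambda>x. x \<in> F) xs)}"
    have "measure_pmf.prob (replicate_pmf (Suc n) p) {xs. t \<le> length (filter (\<lambda>x. x \<in> F) xs)}
        = measure_pmf.expectation p (\<lambda>x. measure_pmf.prob (map_pmf ((#) x) ?R)
            {xs. t \<le> length (filter (\<lambda>x. x \<in> F) xs)})"
      by (simp add: prob_bind_pmf map_pmf_def)
    also have "\<dots> = measure_pmf.expectation p
        (\<lambda>x. indicator F x * ?P s + indicator (- F) x * ?P t)"
      by (rule Bochner_Integration.integral_cong)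
        (auto simp: Suc measure_map_pmf vimage_def indicator_def)
    also have "\<dots> = q * ?P s + (1 - q) * ?P t"
      using measure_pmf.prob_compl[of F p]
      by (subst Bochner_Integration.integral_add) (auto simp: q_def Compl_eq_Diff_UNIV)
    also have "\<dots> \<le> q * ?P s + ?P t"
      by (simp add: q_def left_diff_distrib)
    also have "\<dots> \<le> q * (real (n choose s) * q ^ s) + real (n choose t) * q ^ t"
      using Suc.IH[of s] Suc.IH[of t] by (intro add_mono mult_left_mono) (auto simp: q_def)
    also have "\<dots> = real (Suc n choose t) * q ^ t"
      by (simp add: Suc algebra_simps)
    finally show ?thesis .
  qed
qed

text \<open>The series of \<open>exp\<close> at \<open>k\<close> contains the term
  \<open>k ^ k / k!\<close>, hence \<open>k ^ k \<le> e ^ k * k!\<close>; combine this with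
  \<open>n choose k \<le> n ^ k / k!\<close>.\<close>

lemma binomial_le_exp_pow:
  assumes "0 < k"
  shows "real (n choose k) \<le> (exp 1 * real n / real k) ^ k"
proof -
  have "real k ^ k / fact k \<le> (\<Sum>i. real k ^ i / fact i)"
    using sum_le_suminf[of "\<lambda>i. real k ^ i / fact i" "{k}"] summable_exp[of "real k"]
    by (simp add: field_simps)
  also have "\<dots> = exp (real k)"
    by (simp add: exp_def divide_inverse mult.commute)
  finally have "real k ^ k \<le> exp 1 ^ k * fact k"
    by (simp add: exp_of_nat_mult[symmetric] field_simps)
  moreover have "real (n choose k) * fact k \<le> real n ^ k"
    using binomial_fact_pow[of n k] by (metis of_nat_fact of_nat_le_iff of_nat_mult of_nat_power)
  ultimately have "real (n choose k) * fact k * real k ^ k \<le> real n ^ k * (exp 1 ^ k * fact k)"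
    by (intro mult_mono) auto
  then have "(real (n choose k) * real k ^ k) * fact k \<le> (real n ^ k * exp 1 ^ k) * fact k"
    by (simp only: mult_ac)
  then have "real (n choose k) * real k ^ k \<le> real n ^ k * exp 1 ^ k"
    by (rule mult_right_le_imp_le) simp
  then show ?thesis
    using assms by (simp add: power_divide power_mult_distrib field_simps)
qed

text \<open>
  If every nonempty subfamily has a vertex of small positive degree, orienting all its edges into
  that vertex and recursing yields the orientation.
\<close>
lemma degenerate_orientation:
  fixes g :: "'i \<Rightarrow> 'a set"
  assumes "finite I"
    and "\<And>J. J \<subseteq> I \<Longrightarrow> J \<noteq> {} \<Longrightarrow>
           \<exists>v. {j \<in> J. v \<in> g j} \<noteq> {} \<and> card {j \<in> J. v \<in> g j} \<le> k"
  obtains h where "\<And>i. i \<in> I \<Longrightarrow> h i \<in> g i" "\<And>v. card {i \<in> I. h i = v} \<le> k"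
proof -
  have "\<exists>h. (\<forall>i\<in>I. h i \<in> g i) \<and> (\<forall>v. card {i \<in> I. h i = v} \<le> k)"
    using assms
  proof (induction I rule: finite_psubset_induct)
    case (psubset I)
    show ?case
    proof (cases "I = {}")
      case True
      then show ?thesis by auto
    next
      case False
      then obtain v where v: "{j \<in> I. v \<in> g j} \<noteq> {}" "card {j \<in> I. v \<in> g j} \<le> k"
        using psubset.prems[of I] by blast
      define I' where "I' = {j \<in> I. v \<notin> g j}"
      \<comment> \<open>The degree of \<open>v\<close> in \<open>I\<close> is positive, so removing
        the indices at \<open>v\<close> makes the family strictly smaller.\<close>
      have "I' \<subset> I" using v by (auto simp: I'_def)
      then obtain h where h: "\<forall>i\<in>I'. h i \<in> g i" "\<forall>u. card {i \<in> I'. h i = u} \<le> k"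
        using psubset.IH[of I'] psubset.prems by (meson psubset_imp_subset subset_trans)
      define h' where "h' = (\<lambda>i. if v \<in> g i then v else h i)"
      have "card {i \<in> I. h' i = u} \<le> k" for u
      proof (cases "u = v")
        case True
        have "h i \<noteq> v" if "i \<in> I" "v \<notin> g i" for i
          using h(1) that by (auto simp: I'_def)
        then have "{i \<in> I. h' i = v} = {j \<in> I. v \<in> g j}"
          by (auto simp: h'_def)
        with v(2) True show ?thesis by simp
      next
        case False
        then have "{i \<in> I. h' i = u} = {i \<in> I'. h i = u}"
          by (auto simp: h'_def I'_def)
        with h(2) show ?thesis by simp
      qed
      moreover have "\<forall>i\<in>I. h' i \<in> g i"
        using h(1) by (auto simp: h'_def I'_def)
      ultimately show ?thesis by blast
    qed
  qed
  then show ?thesis using that by blast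
qed

section \<open>The greedy process\<close>

lemma load_append [simp]: "load (hs @ zs) v = load hs v + load zs v"
  by (simp add: load_def)

lemma load_single [simp]: "load [x] v = (if x = v then 1 else 0)"
  by (simp add: load_def)

text \<open>Merges the draw of an edge with its tie-breaking into one transition, which turns the
  list of heads into a Markov chain.\<close>

definition greedy_step :: "'a set set \<Rightarrow> 'a list \<Rightarrow> 'a pmf" where
  "greedy_step E hs = bind_pmf (pmf_of_set E) (\<lambda>e. pmf_of_set (least_loaded hs e))"

text \<open>Starts from an arbitrary history \<open>hs\<close>, so that a run can be resumed at a
  window boundary.\<close>

definition greedy_run :: "'a set set \<Rightarrow> 'a list \<Rightarrow> nat \<Rightarrow> 'a list pmf" where
  "greedy_run E hs T = bind_pmf (iid_arrivals E T) (greedy hs)"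

lemma greedy_run_0 [simp]: "greedy_run E hs 0 = return_pmf hs"
  by (simp add: greedy_run_def iid_arrivals_def bind_return_pmf)

text \<open>\<open>iid_arrivals\<close> draws all edges before any tie is broken. The later draws do
  not depend on the first tie-break, so that tie can be broken right after its own edge is
  drawn.\<close>

lemma greedy_run_Suc:
  "greedy_run E hs (Suc T) = bind_pmf (greedy_step E hs) (\<lambda>v. greedy_run E (hs @ [v]) T)"
proof -
  let ?R = "replicate_pmf T (pmf_of_set E)"
  have "greedy_run E hs (Suc T) = bind_pmf (pmf_of_set E) (\<lambda>e. bind_pmf ?R (\<lambda>es.
      bind_pmf (pmf_of_set (least_loaded hs e)) (\<lambda>v. greedy (hs @ [v]) es)))"
    by (simp add: greedy_run_def iid_arrivals_def bind_assoc_pmf bind_return_pmf)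
  also have "\<dots> = bind_pmf (pmf_of_set E) (\<lambda>e. bind_pmf (pmf_of_set (least_loaded hs e))
      (\<lambda>v. bind_pmf ?R (greedy (hs @ [v]))))"
    by (subst (2) bind_commute_pmf) simp
  finally show ?thesis
    by (simp add: greedy_run_def iid_arrivals_def greedy_step_def bind_assoc_pmf)
qed

lemma greedy_run_add:
  "greedy_run E hs (S + T) = bind_pmf (greedy_run E hs S) (\<lambda>hs'. greedy_run E hs' T)"
  by (induction S arbitrary: hs) (simp_all add: greedy_run_Suc bind_assoc_pmf bind_return_pmf)

lemma greedy_run_load_mono:
  "hs' \<in> set_pmf (greedy_run E hs T) \<Longrightarrow> load hs v \<le> load hs' v"
  by (induction T arbitrary: hs) (fastforce simp: greedy_run_Suc)+

text \<open>If the drawn edge is in \<open>F\<close>, then \<open>v\<close> is among its at most two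
  least loaded ends, so it is chosen with probability at least one half.\<close>

lemma greedy_step_prob:
  assumes E: "finite E" "E \<noteq> {}" "\<And>e. e \<in> E \<Longrightarrow> card e = 2"
    and F: "F \<subseteq> E" "\<And>e. e \<in> F \<Longrightarrow> v \<in> e" "\<And>e u. e \<in> F \<Longrightarrow> u \<in> e \<Longrightarrow> load hs v \<le> load hs u"
  shows "real (card F) / (2 * real (card E)) \<le> pmf (greedy_step E hs) v"
proof -
  have half: "1 / 2 \<le> pmf (pmf_of_set (least_loaded hs e)) v" if "e \<in> F" for e
  proof -
    have "card e = 2" using E(3) F(1) that by blast
    then have e: "card e = 2" "finite e" by (auto intro: card_ge_0_finite)
    have "v \<in> least_loaded hs e" and sub: "least_loaded hs e \<subseteq> e"
      using F that by (auto simp: least_loaded_def)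
    moreover have "finite (least_loaded hs e)" "card (least_loaded hs e) \<le> 2"
      using sub e by (auto intro: finite_subset dest: card_mono)
    moreover have "0 < card (least_loaded hs e)"
      using calculation by (auto simp: card_gt_0_iff)
    ultimately show ?thesis
      by (subst pmf_of_set) (auto simp: field_simps)
  qed
  have "real (card F) / (2 * real (card E)) = measure_pmf.expectation (pmf_of_set E) (\<lambda>e. indicator F e * (1 / 2))"
    using E F(1) by (subst integral_mult_left_zero) (auto simp: measure_pmf_of_set Int_absorb1)
  also have "\<dots> \<le> measure_pmf.expectation (pmf_of_set E) (\<lambda>e. pmf (pmf_of_set (least_loaded hs e)) v)"
    by (rule expectation_pmf_mono[where B = 1]) (use half in \<open>auto simp: indicator_def pmf_le_1\<close>)
  finally show ?thesis
    by (simp add: greedy_step_def pmf_bind)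
qed

text \<open>
  Along the run, \<open>2 ^ (- load v)\<close> restricted to \<open>load v \<le> i\<close> is a supermartingale that
  contracts by a constant factor at each arrival.
\<close>
lemma greedy_run_load_le_prob:
  assumes E: "finite E" "E \<noteq> {}" "\<And>e. e \<in> E \<Longrightarrow> card e = 2"
    and F: "F \<subseteq> E" "\<And>e. e \<in> F \<Longrightarrow> v \<in> e"
    and \<theta>: "\<theta> * real (card E) \<le> real (card F)" "0 \<le> \<theta>"
    and hs: "\<And>e u. e \<in> F \<Longrightarrow> u \<in> e \<Longrightarrow> u \<noteq> v \<Longrightarrow> i \<le> load hs u"
  shows "measure_pmf.prob (greedy_run E hs T) {hs'. load hs' v \<le> i}
           \<le> 2 ^ i / 2 ^ load hs v * (1 - \<theta> / 4) ^ T"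
  using hs
proof (induction T arbitrary: hs)
  have card_E: "0 < real (card E)" using E by (simp add: card_gt_0_iff)
  have "card F \<le> card E" using E(1) F(1) by (rule card_mono)
  then have "\<theta> * real (card E) \<le> 1 * real (card E)" using \<theta>(1) by linarith
  then have \<theta>1: "\<theta> \<le> 1" using card_E by simp
  {
    case 0
    then show ?case
      by (cases "load hs v \<le> i") (auto simp: power_increasing field_simps)
  next
    case (Suc T)
    let ?c = "(1 - \<theta> / 4) ^ T" and ?D = "greedy_step E hs"
    let ?B = "2 ^ i / 2 ^ load hs v * ?c"
    have c: "0 \<le> ?c" using \<theta>1 by simp
    show ?case
    proof (cases "load hs v \<le> i")
      case False
      \<comment> \<open>Loads never decrease, so a load above \<open>i\<close> stays above
        \<open>i\<close>.\<close>
      have "measure_pmf.prob (greedy_run E hs (Suc T)) {hs'. load hs' v \<le> i} = 0"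
        using False greedy_run_load_mono[of _ E hs "Suc T" v]
        by (fastforce simp: measure_pmf_zero_iff)
      then show ?thesis using \<theta>1 by simp
    next
      case True
      have load_le: "load hs v \<le> load hs u" if "e \<in> F" "u \<in> e" for e u
        using Suc.prems[OF that] True by (cases "u = v") auto
      have "real (card F) / (2 * real (card E)) \<le> pmf ?D v"
        using E F load_le by (rule greedy_step_prob)
      moreover have "\<theta> / 2 \<le> real (card F) / (2 * real (card E))"
        using \<theta>(1) card_E by (simp add: field_simps)
      ultimately have step: "\<theta> / 2 \<le> pmf ?D v" by linarith
      have "measure_pmf.prob (greedy_run E hs (Suc T)) {hs'. load hs' v \<le> i}
          = measure_pmf.expectation ?D
              (\<lambda>x. measure_pmf.prob (greedy_run E (hs @ [x]) T) {hs'. load hs' v \<le> i})"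
        by (simp add: greedy_run_Suc prob_bind_pmf)
      \<comment> \<open>A step into \<open>v\<close> halves the bound from the induction hypothesis,
        any other step keeps it. The mean is \<open>?B * (1 - p / 2)\<close> with
        \<open>p = pmf ?D v \<ge> \<theta> / 2\<close>, which gives the factor
        \<open>1 - \<theta> / 4\<close>.\<close>
      also have "\<dots> \<le> measure_pmf.expectation ?D (\<lambda>x. ?B - indicator {v} x * (?B / 2))"
      proof (rule expectation_pmf_mono[where B = ?B])
        fix x
        have "measure_pmf.prob (greedy_run E (hs @ [x]) T) {hs'. load hs' v \<le> i}
            \<le> 2 ^ i / 2 ^ load (hs @ [x]) v * ?c"
          by (rule Suc.IH) (use Suc.prems in \<open>auto intro: le_SucI\<close>)
        also have "\<dots> = ?B - indicator {v} x * (?B / 2)"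
          by (auto simp: indicator_def field_simps)
        finally show "measure_pmf.prob (greedy_run E (hs @ [x]) T) {hs'. load hs' v \<le> i} \<le> \<dots>" .
        show "?B - indicator {v} x * (?B / 2) \<le> ?B"
          using c by (simp add: indicator_def)
      qed simp
      also have "\<dots> = ?B * (1 - pmf ?D v / 2)"
        by (subst Bochner_Integration.integral_diff) (auto simp: pmf.rep_eq field_simps)
      also have "\<dots> \<le> ?B * (1 - \<theta> / 4)"
        using step c by (intro mult_left_mono) auto
      also have "\<dots> = 2 ^ i / 2 ^ load hs v * (1 - \<theta> / 4) ^ Suc T"
        by simp
      finally show ?thesis .
    qed
  }
qed

section \<open>The blown-up tree\<close>

lemma nat_div_eq_iff:
  fixes x k c :: nat
  assumes "0 < k"
  shows "x div k = c \<longleftrightarrow> c * k \<le> x \<and> x < (c + 1) * k"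
  using less_eq_div_iff_mult_less_eq[OF assms, of c x] div_less_iff_less_mult[OF assms, of x "c + 1"]
  by linarith

text \<open>
  The tree has the nodes \<open>0, \<dots>, b\<close>, numbered as in an \<open>r\<close>-ary heap: the parent of \<open>c > 0\<close> is
  \<open>(c - 1) div r\<close>. Vertex \<open>v\<close> lies in the cluster of node \<open>v div b\<close>. An arc points from the child to
  the parent.
\<close>
locale heap_blowup =
  fixes b r :: nat
  assumes b_pos: "0 < b" and r_pos: "0 < r"
begin

text \<open>With \<open>b + 1\<close> nodes there are \<open>b\<close> clusters besides the root,
  each joined to its parent by \<open>b * b\<close> arcs, so the number of edges is exactly
  \<open>b ^ 3\<close>.\<close>

definition V :: "nat set" where
  "V = {..<(b + 1) * b}"

definition cluster :: "nat \<Rightarrow> nat set" where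
  "cluster c = {v. v div b = c}"

text \<open>These are vertices, not nodes. The condition \<open>b \<le> u\<close> excludes the root
  cluster, where the truncated \<open>u div b - 1\<close> would make the root its own child.\<close>

definition children :: "nat \<Rightarrow> nat set" where
  "children c = {u. b \<le> u \<and> u < (b + 1) * b \<and> (u div b - 1) div r = c}"

definition arcs :: "(nat \<times> nat) set" where
  "arcs = (SIGMA u:{b..<(b + 1) * b}. cluster ((u div b - 1) div r))"

abbreviation edge :: "nat \<times> nat \<Rightarrow> nat set" where
  "edge p \<equiv> {fst p, snd p}"

definition E :: "nat set set" where
  "E = edge ` arcs"

definition star :: "nat \<Rightarrow> nat set set" where
  "star c = edge ` (children c \<times> cluster c)"

lemma cluster_eq: "cluster c = {c * b..<(c + 1) * b}"
  using b_pos by (auto simp: cluster_def nat_div_eq_iff)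

lemma card_cluster [simp]: "card (cluster c) = b" and finite_cluster [simp]: "finite (cluster c)"
  by (simp_all add: cluster_eq)

text \<open>Heap numbering makes the child clusters of a node consecutive, so the children form an
  interval; \<open>min\<close> cuts it off at the last vertex.\<close>

lemma children_eq: "children c = {(r * c + 1) * b..<min ((r * c + r + 1) * b) ((b + 1) * b)}"
proof -
  have "b \<le> u \<and> (u div b - 1) div r = c \<longleftrightarrow> (r * c + 1) * b \<le> u \<and> u < (r * c + r + 1) * b" for u
  proof -
    define m where "m = r * c"
    have "b \<le> u \<longleftrightarrow> 1 \<le> u div b"
      using b_pos by (simp add: Suc_le_eq div_greater_zero_iff)
    moreover have "(u div b - 1) div r = c \<longleftrightarrow> m \<le> u div b - 1 \<and> u div b - 1 < m + r"
      unfolding nat_div_eq_iff[OF r_pos] m_def by (simp add: mult.commute add.commute)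
    ultimately have "b \<le> u \<and> (u div b - 1) div r = c \<longleftrightarrow> m + 1 \<le> u div b \<and> u div b < m + r + 1"
      by linarith
    then show ?thesis
      unfolding less_eq_div_iff_mult_less_eq[OF b_pos] div_less_iff_less_mult[OF b_pos] m_def .
  qed
  then have "u \<in> children c \<longleftrightarrow> u \<in> {(r * c + 1) * b..<min ((r * c + r + 1) * b) ((b + 1) * b)}" for u
    unfolding children_def mem_Collect_eq atLeastLessThan_iff min_less_iff_conj by blast
  then show ?thesis by blast
qed

lemma finite_children [simp]: "finite (children c)"
  by (simp add: children_eq)

lemma card_children_le: "card (children c) \<le> r * b"
proof -
  have "card (children c) \<le> (r * c + r + 1) * b - (r * c + 1) * b"
    unfolding children_eq by simp
  also have "\<dots> = r * b"
    by (simp flip: diff_mult_distrib)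
  finally show ?thesis .
qed

lemma card_children_eq:
  assumes "r * c + r \<le> b"
  shows "card (children c) = r * b"
proof -
  have "(r * c + r + 1) * b \<le> (b + 1) * b"
    using assms by (intro mult_le_mono1) simp
  then have "card (children c) = (r * c + r + 1) * b - (r * c + 1) * b"
    unfolding children_eq by simp
  then show ?thesis
    by (simp flip: diff_mult_distrib)
qed

text \<open>The interval of children is cut off only at cluster boundaries, so if it is nonempty it
  contains a whole cluster.\<close>

lemma card_children_ge:
  assumes "children c \<noteq> {}"
  shows "b \<le> card (children c)"
proof -
  have "(r * c + 1) * b < (b + 1) * b"
    using assms by (auto simp: children_eq)
  then have "(r * c + 2) * b \<le> (b + 1) * b"
    by (intro mult_le_mono1) simp
  moreover have "(r * c + 2) * b \<le> (r * c + r + 1) * b"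
    using r_pos by (intro mult_le_mono1) simp
  ultimately have "(r * c + 2) * b \<le> min ((r * c + r + 1) * b) ((b + 1) * b)"
    by (intro min.boundedI)
  moreover have "(r * c + 2) * b = (r * c + 1) * b + b"
    by simp
  ultimately show ?thesis
    unfolding children_eq card_atLeastLessThan by linarith
qed

lemma arcs_iff: "(u, v) \<in> arcs \<longleftrightarrow> (\<exists>c. u \<in> children c \<and> v \<in> cluster c)"
  by (auto simp: arcs_def children_def cluster_def)

lemma child_gt_parent:
  assumes "u \<in> children c" "v \<in> cluster c"
  shows "v div b < u div b" "v < u" "u \<in> V" "v \<in> V"
proof -
  have "v div b \<le> u div b - 1" "1 \<le> u div b"
    using assms b_pos div_le_dividend[of "u div b - 1" r]
    by (auto simp: children_def cluster_def Suc_le_eq div_greater_zero_iff)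
  then show d: "v div b < u div b" by linarith
  show "v < u"
    using d by (metis div_le_mono leD leI)
  then show "u \<in> V" "v \<in> V"
    using assms by (auto simp: children_def V_def)
qed

text \<open>The child is the larger end of an edge, so the pair can be recovered from the
  set.\<close>

lemma inj_on_edge: "inj_on edge arcs"
proof (rule inj_onI)
  fix p q assume p: "p \<in> arcs" "q \<in> arcs" "edge p = edge q"
  then have "snd p < fst p" "snd q < fst q"
    using child_gt_parent(2) by (metis arcs_iff prod.collapse)+
  with p(3) show "p = q"
    by (auto simp: doubleton_eq_iff prod_eq_iff)
qed

lemma finite_arcs: "finite arcs"
  by (simp add: arcs_def)

lemma finite_E: "finite E"
  by (simp add: E_def finite_arcs)

lemma card_E: "card E = b ^ 3"
proof -
  have "card arcs = b * b * b"
    unfolding arcs_def by simp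
  then show ?thesis
    by (simp add: E_def card_image[OF inj_on_edge] power3_eq_cube)
qed

lemma E_nonempty: "E \<noteq> {}"
  using card_E b_pos by auto

lemma edge_in_E: "u \<in> children c \<Longrightarrow> v \<in> cluster c \<Longrightarrow> {u, v} \<in> E"
  unfolding E_def by (rule image_eqI[of _ _ "(u, v)"]) (auto simp: arcs_iff)

lemma E_cases:
  assumes "e \<in> E"
  obtains c u v where "e = {u, v}" "u \<in> children c" "v \<in> cluster c"
proof -
  from assms obtain p where p: "p \<in> arcs" "e = edge p"
    by (auto simp: E_def)
  obtain u v where uv: "p = (u, v)" by fastforce
  with p(1) obtain c where "u \<in> children c" "v \<in> cluster c"
    by (auto simp: arcs_iff)
  with p(2) uv that show thesis by simp
qed

lemma card_edge: "e \<in> E \<Longrightarrow> card e = 2"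
  by (erule E_cases) (auto dest: child_gt_parent(2))

lemma simple_graph: "simple_graph V E"
  unfolding simple_graph_def
  using card_edge by (auto elim!: E_cases dest: child_gt_parent(3,4)) (simp add: V_def)

lemma card_edge_image: "P \<subseteq> arcs \<Longrightarrow> card (edge ` P) = card P"
  by (rule card_image) (rule inj_on_subset[OF inj_on_edge])

section \<open>Vertex degrees\<close>

lemma vertex_degree_eq:
  "vertex_degree E v = card ({p \<in> arcs. fst p = v} \<union> {p \<in> arcs. snd p = v})"
proof -
  let ?P = "{p \<in> arcs. fst p = v} \<union> {p \<in> arcs. snd p = v}"
  have filter_image: "{e \<in> f ` A. Q e} = f ` {p \<in> A. Q (f p)}"
    for f :: "nat \<times> nat \<Rightarrow> nat set" and A Q
    by auto
  have "{p \<in> arcs. v \<in> edge p} = ?P"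
    by (simp only: set_eq_iff mem_Collect_eq Un_iff insert_iff empty_iff) metis
  then have "{e \<in> E. v \<in> e} = edge ` ?P"
    by (simp only: E_def filter_image)
  moreover have "card (edge ` ?P) = card ?P"
    by (rule card_edge_image) (simp only: Un_least Collect_restrict)
  ultimately show ?thesis
    by (simp only: vertex_degree_def)
qed

lemma vertex_degree_le: "vertex_degree E v \<le> (r + 1) * b"
proof -
  have "{p \<in> arcs. fst p = v} \<subseteq> {v} \<times> cluster ((v div b - 1) div r)"
    by (auto simp: arcs_def)
  then have "card {p \<in> arcs. fst p = v} \<le> b"
    using card_mono[of "{v} \<times> cluster ((v div b - 1) div r)"] by (simp add: card_cartesian_product)
  moreover have "{p \<in> arcs. snd p = v} \<subseteq> children (v div b) \<times> {v}"
    by (auto simp: arcs_iff cluster_def)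
  then have "card {p \<in> arcs. snd p = v} \<le> card (children (v div b))"
    using card_mono[of "children (v div b) \<times> {v}"] by (simp add: card_cartesian_product)
  ultimately show ?thesis
    using card_children_le[of "v div b"] card_Un_le[of "{p \<in> arcs. fst p = v}" "{p \<in> arcs. snd p = v}"]
    by (simp add: vertex_degree_eq)
qed

text \<open>A vertex outside the root cluster is joined to all \<open>b\<close> vertices of its
  parent cluster. A root vertex is joined to a whole child cluster, because node 1 exists.\<close>

lemma vertex_degree_ge:
  assumes "v \<in> V"
  shows "b \<le> vertex_degree E v"
proof -
  have "\<exists>P. P \<subseteq> {p \<in> arcs. fst p = v} \<union> {p \<in> arcs. snd p = v} \<and> b \<le> card P"
  proof (cases "b \<le> v")
    case True
    with assms have "{v} \<times> cluster ((v div b - 1) div r) \<subseteq> {p \<in> arcs. fst p = v}"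
      by (auto simp: arcs_def V_def)
    then show ?thesis
      by (intro exI[of _ "{v} \<times> cluster ((v div b - 1) div r)"]) (auto simp: card_cartesian_product)
  next
    case False
    then have v: "v \<in> cluster 0" by (simp add: cluster_def)
    have "b \<in> children 0"
      using b_pos r_pos by (auto simp: children_eq)
    then have "b \<le> card (children 0)"
      using card_children_ge by blast
    then show ?thesis
      using v by (intro exI[of _ "children 0 \<times> {v}"]) (auto simp: arcs_iff card_cartesian_product)
  qed
  then obtain P where P: "P \<subseteq> {p \<in> arcs. fst p = v} \<union> {p \<in> arcs. snd p = v}" "b \<le> card P" by blast
  have "finite ({p \<in> arcs. fst p = v} \<union> {p \<in> arcs. snd p = v})"
    using finite_arcs by simp
  from card_mono[OF this P(1)] P(2) show ?thesis
    by (simp add: vertex_degree_eq)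
qed

section \<open>Growth of the greedy load, window by window\<close>

text \<open>
  The clusters below \<open>(r + 1) ^ (L - Suc i)\<close> have all their children below \<open>(r + 1) ^ (L - i)\<close>, so these
  thresholds replace the levels of the tree.
\<close>
lemma window_prob:
  fixes w :: nat
  assumes L: "(r + 1) ^ L \<le> b" "i < L"
    and hs: "\<And>u. u < (r + 1) ^ (L - i) * b \<Longrightarrow> i \<le> load hs u"
    and v: "v < (r + 1) ^ (L - Suc i) * b"
  shows "measure_pmf.prob (greedy_run E hs w) {hs'. load hs' v \<le> i}
           \<le> 2 ^ L * (1 - real r / real b ^ 2 / 4) ^ w"
proof -
  define c where "c = v div b"
  have v_cl: "v \<in> cluster c" by (simp add: cluster_def c_def)
  have "c < (r + 1) ^ (L - Suc i)"
    using v by (simp add: c_def less_mult_imp_div_less)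
  \<comment> \<open>The last possible child of node \<open>c\<close> is \<open>r * c + r\<close>,
    which has to lie below the threshold of the previous window.\<close>
  then have "r * c + r + 1 \<le> r * (r + 1) ^ (L - Suc i) + (r + 1) ^ (L - Suc i)"
    using mult_le_mono2[of "c + 1" "(r + 1) ^ (L - Suc i)" r] by simp
  also have "\<dots> = (r + 1) ^ Suc (L - Suc i)"
    by simp
  also have "Suc (L - Suc i) = L - i"
    using \<open>i < L\<close> by simp
  finally have top: "r * c + r + 1 \<le> (r + 1) ^ (L - i)" .
  also have "\<dots> \<le> (r + 1) ^ L"
    by (intro power_increasing) auto
  \<comment> \<open>So node \<open>c\<close> has all of its \<open>r\<close> children, and
    \<open>v\<close> has exactly \<open>r * b\<close> edges to child vertices.\<close>
  finally have cb: "r * c + r \<le> b" using L by simp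
  define F where "F = edge ` (children c \<times> {v})"
  have card_F: "card F = r * b"
    unfolding F_def using v_cl
    by (subst card_edge_image) (auto simp: arcs_iff card_cartesian_product card_children_eq[OF cb])
  have r_le: "real r \<le> real b ^ 2"
  proof -
    have "r * 1 \<le> b * b" using cb b_pos by (intro mult_mono) auto
    then have "real (r * 1) \<le> real (b * b)" by (simp only: of_nat_le_iff)
    then show ?thesis by (simp add: power2_eq_square)
  qed
  have "measure_pmf.prob (greedy_run E hs w) {hs'. load hs' v \<le> i}
      \<le> 2 ^ i / 2 ^ load hs v * (1 - real r / real b ^ 2 / 4) ^ w"
  proof (rule greedy_run_load_le_prob[OF finite_E E_nonempty card_edge])
    show "F \<subseteq> E" unfolding F_def using v_cl by (auto intro: edge_in_E)
    show "v \<in> e" if "e \<in> F" for e using that by (auto simp: F_def)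
    \<comment> \<open>The edges in \<open>F\<close> are a fraction \<open>r / b ^ 2\<close> of all
      \<open>b ^ 3\<close> edges.\<close>
    show "real r / real b ^ 2 * real (card E) \<le> real (card F)"
      using b_pos by (simp add: card_E card_F power2_eq_square power3_eq_cube)
    fix e u assume "e \<in> F" "u \<in> e" "u \<noteq> v"
    then have "u < (r * c + r + 1) * b"
      by (auto simp: F_def children_eq)
    also have "\<dots> \<le> (r + 1) ^ (L - i) * b"
      using top by (rule mult_le_mono1)
    finally show "i \<le> load hs u" by (rule hs)
  qed auto
  also have "\<dots> \<le> 2 ^ L * (1 - real r / real b ^ 2 / 4) ^ w"
  proof (rule mult_right_mono)
    have "(2::real) ^ i / 2 ^ load hs v \<le> 2 ^ i" by (simp add: field_simps)
    also have "\<dots> \<le> 2 ^ L" using \<open>i < L\<close> by (intro power_increasing) auto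
    finally show "(2::real) ^ i / 2 ^ load hs v \<le> 2 ^ L" .
    have "real r / real b ^ 2 \<le> 1" using r_le b_pos by simp
    then show "0 \<le> (1 - real r / real b ^ 2 / 4) ^ w" by simp
  qed
  finally show ?thesis .
qed

text \<open>If the loads required after \<open>i\<close> windows are present,
  \<open>window_prob\<close> and a union bound over at most \<open>(b + 1) * b\<close> vertices show
  that the next window fails with probability at most \<open>\<epsilon>\<close>; failures add
  up.\<close>

lemma windows_prob:
  fixes w :: nat
  assumes L: "(r + 1) ^ L \<le> b" "i \<le> L" and r: "r \<le> b"
  defines "\<epsilon> \<equiv> real ((b + 1) * b) * (2 ^ L * (1 - real r / real b ^ 2 / 4) ^ w)"
  shows "measure_pmf.prob (greedy_run E [] (i * w))
           {hs. \<not> (\<forall>u < (r + 1) ^ (L - i) * b. i \<le> load hs u)} \<le> real i * \<epsilon>"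
  using L(2)
proof (induction i)
  case 0
  then show ?case by simp
next
  case (Suc i)
  have "real r / real b ^ 2 \<le> 1"
  proof -
    have "r * 1 \<le> b * b" using r b_pos by (intro mult_mono) auto
    then have "real (r * 1) \<le> real (b * b)" by (simp only: of_nat_le_iff)
    then show ?thesis using b_pos by (simp add: power2_eq_square)
  qed
  then have factor: "0 \<le> 2 ^ L * (1 - real r / real b ^ 2 / 4) ^ w"
    by simp
  then have \<epsilon>: "0 \<le> \<epsilon>"
    unfolding \<epsilon>_def by (rule mult_nonneg_nonneg[OF of_nat_0_le_iff])
  let ?good = "\<lambda>i hs. \<forall>u < (r + 1) ^ (L - i) * b. i \<le> load hs u"
  have run: "greedy_run E [] (Suc i * w)
      = bind_pmf (greedy_run E [] (i * w)) (\<lambda>hs. greedy_run E hs w)"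
    by (simp add: greedy_run_add[symmetric] add.commute)
  have "measure_pmf.prob (greedy_run E [] (Suc i * w)) {hs. \<not> ?good (Suc i) hs}
      \<le> measure_pmf.prob (greedy_run E [] (i * w)) {hs. \<not> ?good i hs} + \<epsilon>"
    unfolding run
  proof (rule prob_bind_pmf_le[OF _ \<epsilon>])
    fix hs assume "hs \<notin> {hs. \<not> ?good i hs}"
    then have hs: "\<And>u. u < (r + 1) ^ (L - i) * b \<Longrightarrow> i \<le> load hs u" by simp
    let ?U = "{..<(r + 1) ^ (L - Suc i) * b}"
    have "measure_pmf.prob (greedy_run E hs w) {hs'. \<not> ?good (Suc i) hs'}
        = measure_pmf.prob (greedy_run E hs w) (\<Union>v\<in>?U. {hs'. load hs' v \<le> i})"
      by (rule arg_cong[where f = "measure_pmf.prob _"]) (auto simp: not_le less_Suc_eq_le)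
    also have "\<dots> \<le> (\<Sum>v\<in>?U. measure_pmf.prob (greedy_run E hs w) {hs'. load hs' v \<le> i})"
      by (rule measure_pmf.finite_measure_subadditive_finite) auto
    also have "\<dots> \<le> (\<Sum>v\<in>?U. 2 ^ L * (1 - real r / real b ^ 2 / 4) ^ w)"
      using L Suc.prems hs by (intro sum_mono window_prob) auto
    also have "\<dots> = real ((r + 1) ^ (L - Suc i) * b) * (2 ^ L * (1 - real r / real b ^ 2 / 4) ^ w)"
      by simp
    also have "\<dots> \<le> \<epsilon>"
    proof -
      have "(r + 1) ^ (L - Suc i) \<le> (r + 1) ^ L"
        by (intro power_increasing) auto
      then have "(r + 1) ^ (L - Suc i) * b \<le> (b + 1) * b"
        using L by (intro mult_le_mono1) simp
      then have "real ((r + 1) ^ (L - Suc i) * b) \<le> real ((b + 1) * b)"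
        by (simp only: of_nat_le_iff)
      then show ?thesis unfolding \<epsilon>_def using factor by (rule mult_right_mono)
    qed
    finally show "measure_pmf.prob (greedy_run E hs w) {hs'. \<not> ?good (Suc i) hs'} \<le> \<epsilon>" .
  qed
  also have "\<dots> \<le> real i * \<epsilon> + \<epsilon>"
    using Suc by simp
  also have "\<dots> = real (Suc i) * \<epsilon>"
    by (simp add: algebra_simps)
  finally show ?case .
qed

text \<open>After \<open>L\<close> successful windows the threshold is \<open>(r + 1) ^ 0\<close>,
  so the root cluster, and vertex 0 in it, has load at least \<open>L\<close>. The
  \<open>n mod L\<close> remaining arrivals cannot lower it.\<close>

lemma greedy_max_load_prob:
  assumes L: "(r + 1) ^ L \<le> b" and r: "r \<le> b"
  shows "measure_pmf.prob (greedy_max_load V E n) {m. L \<le> m}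
           \<ge> 1 - real L * (real ((b + 1) * b) * (2 ^ L * (1 - real r / real b ^ 2 / 4) ^ (n div L)))"
    (is "_ \<ge> 1 - ?\<delta>")
proof -
  let ?w = "n div L" and ?bad = "{hs. \<not> (\<forall>u < (r + 1) ^ (L - L) * b. L \<le> load hs u)}"
  have run: "greedy_run E [] n
      = bind_pmf (greedy_run E [] (L * ?w)) (\<lambda>hs. greedy_run E hs (n mod L))"
    by (simp flip: greedy_run_add)
  have "measure_pmf.prob (greedy_run E [] n) {hs. \<not> L \<le> max_load V hs}
      \<le> measure_pmf.prob (greedy_run E [] (L * ?w)) ?bad + 0"
    unfolding run
  proof (rule prob_bind_pmf_le)
    fix hs assume "hs \<notin> ?bad"
    then have hs: "L \<le> load hs 0" using b_pos by simp
    have "L \<le> max_load V hs'" if "hs' \<in> set_pmf (greedy_run E hs (n mod L))" for hs'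
    proof -
      have "load hs' 0 \<le> max_load V hs'"
        unfolding max_load_def using b_pos by (intro Max_ge) (auto simp: V_def)
      with hs greedy_run_load_mono[OF that, of 0] show ?thesis by linarith
    qed
    then show "measure_pmf.prob (greedy_run E hs (n mod L)) {hs. \<not> L \<le> max_load V hs} \<le> 0"
      by (subst measure_pmf_zero_iff[THEN iffD2]) auto
  qed simp
  also have "\<dots> \<le> ?\<delta>"
    using windows_prob[OF L order_refl r, of ?w] by simp
  finally have "measure_pmf.prob (greedy_run E [] n) {hs. \<not> L \<le> max_load V hs} \<le> ?\<delta>" .
  moreover have "measure_pmf.prob (greedy_max_load V E n) {m. L \<le> m}
      = measure_pmf.prob (greedy_run E [] n) (UNIV - {hs. \<not> L \<le> max_load V hs})"
    by (simp add: greedy_max_load_def greedy_run_def measure_map_pmf vimage_def Diff_eq Collect_neg_eq)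
  moreover have "\<dots> = 1 - measure_pmf.prob (greedy_run E [] n) {hs. \<not> L \<le> max_load V hs}"
    using measure_pmf.prob_compl[of "{hs. \<not> L \<le> max_load V hs}" "greedy_run E [] n"] by simp
  ultimately show ?thesis by linarith
qed

section \<open>The offline optimum\<close>

text \<open>Both sides have prescribed sizes, so within a star the union bound is indexed by
  \<open>m\<close> alone; smaller cores get padded. The parent side is capped because a cluster has
  only \<open>b\<close> vertices.\<close>

definition heavy :: "nat \<Rightarrow> nat \<Rightarrow> nat \<Rightarrow> nat set list set" where
  "heavy K c m = {es. \<exists>A B. A \<subseteq> children c \<and> card A = m \<and> B \<subseteq> cluster c \<and> card B = min m b \<and>
     K * m \<le> length (filter (\<lambda>e. e \<in> edge ` (A \<times> B)) es)}"

text \<open>Union bound over the choices of \<open>A\<close> and \<open>B\<close>: a drawn edge runs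
  between them with probability \<open>m * min m b / b ^ 3\<close>, and
  \<open>replicate_pmf_count_ge\<close> bounds the count.\<close>

lemma heavy_prob:
  "measure_pmf.prob (iid_arrivals E n) (heavy K c m)
     \<le> real (r * b choose m) * real (b choose min m b) *
       (real (n choose (K * m)) * (real (m * min m b) / real b ^ 3) ^ (K * m))"
proof -
  define S where "S = {A. A \<subseteq> children c \<and> card A = m} \<times> {B. B \<subseteq> cluster c \<and> card B = min m b}"
  define X where "X = (\<lambda>(A, B). {es. K * m \<le> length (filter (\<lambda>e. e \<in> edge ` (A \<times> B)) es)})"
  let ?p = "real (n choose (K * m)) * (real (m * min m b) / real b ^ 3) ^ (K * m)"
  have S: "finite S" "card S = (card (children c) choose m) * (b choose min m b)"
    by (auto simp: S_def card_cartesian_product n_subsets)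
  have "heavy K c m = (\<Union>s\<in>S. X s)"
    by (auto simp: heavy_def S_def X_def)
  then have "measure_pmf.prob (iid_arrivals E n) (heavy K c m)
      \<le> (\<Sum>s\<in>S. measure_pmf.prob (iid_arrivals E n) (X s))"
    using S(1) measure_pmf.finite_measure_subadditive_finite[of S X] by simp
  also have "\<dots> \<le> (\<Sum>s\<in>S. ?p)"
  proof (rule sum_mono)
    fix s assume "s \<in> S"
    then obtain A B where s: "s = (A, B)" "A \<subseteq> children c" "card A = m" "B \<subseteq> cluster c" "card B = min m b"
      by (auto simp: S_def)
    have sub: "A \<times> B \<subseteq> arcs"
      using s(2,4) by (auto intro: arcs_iff[THEN iffD2])
    have "card (edge ` (A \<times> B)) = m * min m b"
      using s by (subst card_edge_image[OF sub]) (simp add: card_cartesian_product)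
    moreover have "edge ` (A \<times> B) \<subseteq> E"
      unfolding E_def using sub by (rule image_mono)
    ultimately have q: "measure_pmf.prob (pmf_of_set E) (edge ` (A \<times> B)) = real (m * min m b) / real b ^ 3"
      by (simp add: measure_pmf_of_set E_nonempty finite_E card_E Int_absorb1)
    show "measure_pmf.prob (iid_arrivals E n) (X s) \<le> ?p"
      using replicate_pmf_count_ge[of n "pmf_of_set E" "K * m" "edge ` (A \<times> B)"]
      unfolding iid_arrivals_def q by (simp add: X_def s(1))
  qed
  also have "\<dots> = real (card (children c) choose m) * real (b choose min m b) * ?p"
    by (simp add: S(2))
  also have "\<dots> \<le> real (r * b choose m) * real (b choose min m b) * ?p"
    using binomial_right_mono[OF card_children_le] by (intro mult_right_mono) auto
  finally show ?thesis .
qed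

section \<open>Peeling the sampled edges of one star\<close>

lemma star_cases:
  assumes "e \<in> star c"
  obtains u v where "e = {u, v}" "u \<in> children c" "v \<in> cluster c"
  using assms by (auto simp: star_def)

lemma star_meets_once:
  assumes "e \<in> star c"
  shows "\<exists>y. e \<inter> children c \<subseteq> {y}" "\<exists>y. e \<inter> cluster c \<subseteq> {y}"
proof -
  from assms obtain u v where uv: "e = {u, v}" "u \<in> children c" "v \<in> cluster c"
    by (rule star_cases)
  have "u \<notin> cluster c" "v \<notin> children c"
    using child_gt_parent(1)[OF uv(2,3)] child_gt_parent(1)[of v c v] uv(3) by (auto simp: cluster_def)
  then have "e \<inter> children c \<subseteq> {u}" "e \<inter> cluster c \<subseteq> {v}"
    unfolding uv(1) by auto
  then show "\<exists>y. e \<inter> children c \<subseteq> {y}" "\<exists>y. e \<inter> cluster c \<subseteq> {y}"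
    by (auto intro: exI[of _ u] exI[of _ v])
qed

text \<open>Double counting: each \<open>g j\<close> has at most one point in \<open>Y\<close>, so
  the index sets belonging to distinct points of \<open>X\<close> are disjoint.\<close>

lemma card_ge_of_degrees:
  assumes "finite J" "finite X"
    and "\<And>x. x \<in> X \<Longrightarrow> K \<le> card {j \<in> J. x \<in> g j}"
    and "\<And>j. j \<in> J \<Longrightarrow> \<exists>y. g j \<inter> Y \<subseteq> {y}" and "X \<subseteq> Y"
  shows "K * card X \<le> card J"
proof -
  have "card X * K \<le> (\<Sum>x\<in>X. card {j \<in> J. x \<in> g j})"
    using sum_bounded_below[of X K "\<lambda>x. card {j \<in> J. x \<in> g j}"] assms(3) by simp
  also have "\<dots> = card (\<Union>x\<in>X. {j \<in> J. x \<in> g j})"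
  proof (rule card_UN_disjoint[symmetric])
    show "\<forall>x\<in>X. \<forall>y\<in>X. x \<noteq> y \<longrightarrow> {j \<in> J. x \<in> g j} \<inter> {j \<in> J. y \<in> g j} = {}"
    proof (intro ballI impI equals0I)
      fix x y j assume x: "x \<in> X" "y \<in> X" "x \<noteq> y" and "j \<in> {j \<in> J. x \<in> g j} \<inter> {j \<in> J. y \<in> g j}"
      then have j: "j \<in> J" "x \<in> g j" "y \<in> g j" by auto
      from assms(4)[OF j(1)] obtain z where "g j \<inter> Y \<subseteq> {z}" ..
      with j x assms(5) have "x = z" "y = z" by auto
      with x show False by simp
    qed
  qed (use assms in auto)
  also have "\<dots> \<le> card J"
    using assms(1) by (intro card_mono) auto
  finally show ?thesis by (simp add: mult.commute)
qed

text \<open>If peeling gets stuck, some set \<open>J\<close> of arrivals has all its vertices of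
  degree above \<open>k\<close>. Counting from the larger side, of size \<open>m\<close>, gives at
  least \<open>Suc k * m\<close> arrivals, and padding both sides yields a \<open>heavy\<close>
  event.\<close>

lemma star_orientation:
  assumes not_heavy: "\<And>m. m \<in> {1..r * b} \<Longrightarrow> es \<notin> heavy (Suc k) c m"
  obtains h where "\<And>i. i < length es \<Longrightarrow> es ! i \<in> star c \<Longrightarrow> h i \<in> es ! i"
    "\<And>v. card {i. i < length es \<and> es ! i \<in> star c \<and> h i = v} \<le> k"
proof -
  define I where "I = {i. i < length es \<and> es ! i \<in> star c}"
  have "\<exists>v. {j \<in> J. v \<in> es ! j} \<noteq> {} \<and> card {j \<in> J. v \<in> es ! j} \<le> k" if J: "J \<subseteq> I" "J \<noteq> {}" for J
  proof (rule ccontr)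
    assume "\<not> ?thesis"
    then have deg: "Suc k \<le> card {j \<in> J. v \<in> es ! j}" if "{j \<in> J. v \<in> es ! j} \<noteq> {}" for v
      using that by (auto simp: not_le Suc_le_eq)
    have fin: "finite J" using J(1) by (auto simp: I_def intro: finite_subset)
    have star: "es ! j \<in> star c" if "j \<in> J" for j using J(1) that by (auto simp: I_def)
    define A where "A = {u \<in> children c. \<exists>j\<in>J. u \<in> es ! j}"
    define B where "B = {v \<in> cluster c. \<exists>j\<in>J. v \<in> es ! j}"
    define m where "m = max (card A) (card B)"
    have finAB: "finite A" "finite B" by (simp_all add: A_def B_def)
    have "Suc k * card A \<le> card J"
      using fin finAB(1)
    proof (rule card_ge_of_degrees[where Y = "children c" and g = "(!) es"])
      show "\<exists>y. es ! j \<inter> children c \<subseteq> {y}" if "j \<in> J" for j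
        using star[OF that] by (rule star_meets_once)
      show "Suc k \<le> card {j \<in> J. x \<in> es ! j}" if "x \<in> A" for x
        using that by (intro deg) (auto simp: A_def)
      show "A \<subseteq> children c" by (auto simp: A_def)
    qed
    moreover have "Suc k * card B \<le> card J"
      using fin finAB(2)
    proof (rule card_ge_of_degrees[where Y = "cluster c" and g = "(!) es"])
      show "\<exists>y. es ! j \<inter> cluster c \<subseteq> {y}" if "j \<in> J" for j
        using star[OF that] by (rule star_meets_once)
      show "Suc k \<le> card {j \<in> J. x \<in> es ! j}" if "x \<in> B" for x
        using that by (intro deg) (auto simp: B_def)
      show "B \<subseteq> cluster c" by (auto simp: B_def)
    qed
    ultimately have card_J: "Suc k * m \<le> card J"
      by (auto simp: m_def max_def)
    obtain j where "j \<in> J" using J(2) by blast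
    then obtain u v where "es ! j = {u, v}" "u \<in> children c"
      using star_cases[OF star] by metis
    with \<open>j \<in> J\<close> have "u \<in> A" by (auto simp: A_def)
    then have "A \<noteq> {}" by blast
    then have "children c \<noteq> {}" "0 < card A"
      using finAB by (auto simp: A_def card_gt_0_iff)
    have "card A \<le> card (children c)"
      by (rule card_mono) (auto simp: A_def)
    moreover have "card B \<le> b"
      using card_mono[of "cluster c" B] by (auto simp: B_def)
    \<comment> \<open>The larger side may be \<open>B\<close>. Then \<open>A\<close> can be padded
      to size \<open>m\<close> because a nonempty set of children has at least \<open>b\<close>
      elements.\<close>
    moreover note card_children_ge[OF \<open>children c \<noteq> {}\<close>]
    ultimately have m: "m \<le> card (children c)" "card A \<le> m" "card B \<le> min m b" "0 < m"
      using \<open>0 < card A\<close> by (auto simp: m_def)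
    obtain A' where A': "A \<subseteq> A'" "A' \<subseteq> children c" "card A' = m"
      using exists_subset_between[OF m(2,1) _ finite_children] by (auto simp: A_def)
    obtain B' where B': "B \<subseteq> B'" "B' \<subseteq> cluster c" "card B' = min m b"
      using exists_subset_between[OF m(3), of "cluster c"] by (auto simp: B_def)
    have "es ! j \<in> edge ` (A' \<times> B')" if j: "j \<in> J" for j
    proof -
      obtain u v where uv: "es ! j = {u, v}" "u \<in> children c" "v \<in> cluster c"
        using star[OF j] by (rule star_cases)
      then have "u \<in> A" "v \<in> B" using j by (auto simp: A_def B_def)
      then have "(u, v) \<in> A' \<times> B'" using A'(1) B'(1) by blast
      then show ?thesis unfolding uv(1) by (rule rev_image_eqI) simp
    qed
    then have "J \<subseteq> {i. i < length es \<and> es ! i \<in> edge ` (A' \<times> B')}"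
      using J(1) by (auto simp: I_def)
    then have "card J \<le> card {i. i < length es \<and> es ! i \<in> edge ` (A' \<times> B')}"
      by (intro card_mono) auto
    then have "Suc k * m \<le> length (filter (\<lambda>e. e \<in> edge ` (A' \<times> B')) es)"
      unfolding length_filter_conv_card using card_J by linarith
    then have "es \<in> heavy (Suc k) c m"
      unfolding heavy_def using A'(2,3) B'(2,3) by blast
    moreover have "m \<in> {1..r * b}"
      using m card_children_le[of c] by simp
    ultimately show False using not_heavy by blast
  qed
  moreover have "finite I" by (simp add: I_def)
  ultimately obtain h where "\<And>i. i \<in> I \<Longrightarrow> h i \<in> es ! i" "\<And>v. card {i \<in> I. h i = v} \<le> k"
    using degenerate_orientation[of I "(!) es" k] by blast
  then show thesis
    by (intro that[of h]) (auto simp: I_def conj_assoc)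
qed

section \<open>Combining the stars\<close>

lemma E_star:
  assumes "e \<in> E"
  obtains c where "c \<le> b" "e \<in> star c"
proof -
  from assms obtain c u v where e: "e = {u, v}" "u \<in> children c" "v \<in> cluster c"
    by (rule E_cases)
  then have "e \<in> star c"
    unfolding star_def by (intro image_eqI[of _ _ "(u, v)"]) auto
  moreover have "v < (b + 1) * b" "v div b = c"
    using child_gt_parent(4)[OF e(2,3)] e(3) by (auto simp: V_def cluster_def)
  then have "c < b + 1" by (metis less_mult_imp_div_less)
  ultimately show thesis by (intro that[of c]) auto
qed

text \<open>A vertex is a parent end only in the star of its own cluster and a child end only in
  that of its parent cluster, so it lies in at most two stars.\<close>

lemma star_index:
  assumes "e \<in> star c" "v \<in> e"
  shows "c = v div b \<or> c = (v div b - 1) div r"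
  using assms by (auto simp: star_def children_def cluster_def)

lemma opt_max_load_le:
  assumes h: "\<And>i. i < length es \<Longrightarrow> h i \<in> es ! i"
    and V': "finite V'" "V' \<noteq> {}"
    and load: "\<And>v. card {i. i < length es \<and> h i = v} \<le> k"
  shows "opt_max_load V' es \<le> k"
proof -
  let ?hs = "map h [0..<length es]"
  have or: "?hs \<in> orientations es"
    using h by (auto simp: orientations_def list_all2_conv_all_nth)
  have "load ?hs v \<le> k" for v
  proof -
    have "load ?hs v = card {i. i < length ?hs \<and> v = ?hs ! i}"
      unfolding load_def count_list_eq_length_filter length_filter_conv_card by simp
    also have "{i. i < length ?hs \<and> v = ?hs ! i} = {i. i < length es \<and> h i = v}"
      by auto
    finally show ?thesis using load by simp
  qed
  then have "max_load V' ?hs \<le> k"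
    unfolding max_load_def using V' by (intro Max.boundedI) auto
  \<comment> \<open>\<open>Min\<close> needs a finite set of values. The edges here may be infinite
    sets, but every load is bounded by the number of arrivals.\<close>
  moreover have "finite (max_load V' ` orientations es)"
  proof (rule finite_subset)
    show "max_load V' ` orientations es \<subseteq> {..length es}"
    proof (rule image_subsetI)
      fix hs assume "hs \<in> orientations es"
      then have "length hs = length es" by (auto simp: orientations_def dest: list_all2_lengthD)
      then have "load hs v \<le> length es" for v
        using count_le_length[of hs v] by (simp add: load_def)
      then show "max_load V' hs \<in> {..length es}"
        unfolding max_load_def using V' by (auto intro!: Max.boundedI)
    qed
  qed simp
  ultimately show ?thesis
    unfolding opt_max_load_def using or by (intro Min.coboundedI[THEN order_trans]) auto
qed

lemma V_finite_nonempty: "finite V" "V \<noteq> {}"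
  using b_pos by (auto simp: V_def)

text \<open>Each arrival follows the orientation of a star that contains it; the at most two stars
  at a vertex each add at most \<open>k\<close> to its load.\<close>

lemma opt_le_of_not_heavy:
  assumes es: "set es \<subseteq> E"
    and not_heavy: "\<And>c m. c \<le> b \<Longrightarrow> m \<in> {1..r * b} \<Longrightarrow> es \<notin> heavy (Suc k) c m"
  shows "opt_max_load V es \<le> 2 * k"
proof -
  have "\<exists>h. c \<le> b \<longrightarrow> (\<forall>i. i < length es \<longrightarrow> es ! i \<in> star c \<longrightarrow> h i \<in> es ! i) \<and>
      (\<forall>v. card {i. i < length es \<and> es ! i \<in> star c \<and> h i = v} \<le> k)" for c
  proof (cases "c \<le> b")
    case True
    from star_orientation[OF not_heavy[OF True]] obtain h
      where "\<And>i. i < length es \<Longrightarrow> es ! i \<in> star c \<Longrightarrow> h i \<in> es ! i"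
        "\<And>v. card {i. i < length es \<and> es ! i \<in> star c \<and> h i = v} \<le> k"
      by blast
    then show ?thesis by blast
  qed simp
  then obtain h where hc: "\<forall>c. c \<le> b \<longrightarrow>
      (\<forall>i. i < length es \<longrightarrow> es ! i \<in> star c \<longrightarrow> h c i \<in> es ! i) \<and>
      (\<forall>v. card {i. i < length es \<and> es ! i \<in> star c \<and> h c i = v} \<le> k)"
    using choice[of "\<lambda>c h. c \<le> b \<longrightarrow> (\<forall>i. i < length es \<longrightarrow> es ! i \<in> star c \<longrightarrow> h i \<in> es ! i) \<and>
      (\<forall>v. card {i. i < length es \<and> es ! i \<in> star c \<and> h i = v} \<le> k)"] by blast
  then have h: "\<And>c i. c \<le> b \<Longrightarrow> i < length es \<Longrightarrow> es ! i \<in> star c \<Longrightarrow> h c i \<in> es ! i"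
    and load: "\<And>c v. c \<le> b \<Longrightarrow> card {i. i < length es \<and> es ! i \<in> star c \<and> h c i = v} \<le> k"
    by blast+
  define s where "s = (\<lambda>i. SOME c. c \<le> b \<and> es ! i \<in> star c)"
  have s: "s i \<le> b" "es ! i \<in> star (s i)" if "i < length es" for i
  proof -
    have "es ! i \<in> E" using es that by auto
    then have "\<exists>c. c \<le> b \<and> es ! i \<in> star c" by (rule E_star) blast
    from someI_ex[OF this] show "s i \<le> b" "es ! i \<in> star (s i)"
      by (auto simp: s_def)
  qed
  show ?thesis
  proof (rule opt_max_load_le[where h = "\<lambda>i. h (s i) i"])
    show "h (s i) i \<in> es ! i" if "i < length es" for i
      using h s that by blast
    fix v
    \<comment> \<open>The conjunct \<open>c \<le> b\<close> makes \<open>I c\<close> empty beyond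
      the last node, where \<open>load\<close> says nothing.\<close>
    define I where "I = (\<lambda>c. {i. i < length es \<and> es ! i \<in> star c \<and> h c i = v \<and> c \<le> b})"
    have I: "card (I c) \<le> k" "finite (I c)" for c
      using load[of c v] by (cases "c \<le> b"; auto simp: I_def)+
    have "{i. i < length es \<and> h (s i) i = v} \<subseteq> I (v div b) \<union> I ((v div b - 1) div r)"
    proof
      fix i assume "i \<in> {i. i < length es \<and> h (s i) i = v}"
      then have i: "i < length es" "h (s i) i = v" by auto
      then have "v \<in> es ! i" using h s by blast
      with star_index[OF s(2)[OF i(1)]] have "s i = v div b \<or> s i = (v div b - 1) div r" by blast
      moreover have "i \<in> I (s i)" using i s by (simp add: I_def)
      ultimately show "i \<in> I (v div b) \<union> I ((v div b - 1) div r)" by auto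
    qed
    then have "card {i. i < length es \<and> h (s i) i = v} \<le> card (I (v div b) \<union> I ((v div b - 1) div r))"
      using I(2) by (intro card_mono) auto
    also have "\<dots> \<le> 2 * k"
      using card_Un_le[of "I (v div b)" "I ((v div b - 1) div r)"] I(1)[of "v div b"]
        I(1)[of "(v div b - 1) div r"] by linarith
    finally show "card {i. i < length es \<and> h (s i) i = v} \<le> 2 * k" .
  qed (use V_finite_nonempty in auto)
qed

lemma opt_le_length:
  assumes es: "set es \<subseteq> E"
  shows "opt_max_load V es \<le> length es"
proof -
  have "es ! i \<noteq> {}" if "i < length es" for i
    using es that card_edge by (metis card.empty nth_mem subset_eq zero_neq_numeral)
  then have "(SOME v. v \<in> es ! i) \<in> es ! i" if "i < length es" for i
    using that by (simp add: some_in_eq)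
  moreover have "card {i. i < length es \<and> (SOME v. v \<in> es ! i) = v} \<le> length es" for v
    using card_mono[of "{..<length es}"] by (metis (no_types, lifting) card_lessThan finite_lessThan lessThan_iff mem_Collect_eq subsetI)
  ultimately show ?thesis
    using V_finite_nonempty by (intro opt_max_load_le[where h = "\<lambda>i. SOME v. v \<in> es ! i"])
qed

text \<open>The optimum is at most \<open>2 * k\<close> unless one of the
  \<open>(b + 1) * (r * b)\<close> events \<open>heavy\<close> occurs, and even then it is at most
  \<open>n\<close>.\<close>

lemma OPT_le:
  assumes heavy: "\<And>c m. c \<le> b \<Longrightarrow> m \<in> {1..r * b} \<Longrightarrow>
      measure_pmf.prob (iid_arrivals E n) (heavy (Suc k) c m) \<le> \<delta>"
  shows "OPT V E n \<le> 2 * real k + real n * (real (b + 1) * real (r * b) * \<delta>)"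
proof -
  define I where "I = {..b} \<times> {1..r * b}"
  define bad where "bad = (\<Union>(c, m)\<in>I. heavy (Suc k) c m)"
  let ?M = "iid_arrivals E n"
  have "measure_pmf.prob ?M bad \<le> (\<Sum>x\<in>I. measure_pmf.prob ?M (case x of (c, m) \<Rightarrow> heavy (Suc k) c m))"
    unfolding bad_def by (rule measure_pmf.finite_measure_subadditive_finite) (auto simp: I_def)
  also have "\<dots> \<le> (\<Sum>x\<in>I. \<delta>)"
    by (rule sum_mono) (use heavy in \<open>auto simp: I_def\<close>)
  also have "\<dots> = real (b + 1) * real (r * b) * \<delta>"
    by (simp add: I_def card_cartesian_product algebra_simps)
  finally have bad: "measure_pmf.prob ?M bad \<le> real (b + 1) * real (r * b) * \<delta>" .
  have supp: "set es \<subseteq> E" "length es = n" if "es \<in> set_pmf ?M" for es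
    using that by (auto simp: iid_arrivals_def set_replicate_pmf finite_E E_nonempty lists_eq_set)
  have "OPT V E n \<le> measure_pmf.expectation ?M (\<lambda>es. 2 * real k + real n * indicator bad es)"
    unfolding OPT_def
  proof (rule expectation_pmf_mono[where B = "2 * real k + real n"])
    fix es assume es: "es \<in> set_pmf ?M"
    show "real (opt_max_load V es) \<le> 2 * real k + real n * indicator bad es"
    proof (cases "es \<in> bad")
      case True
      have "real (opt_max_load V es) \<le> real n"
        using opt_le_length supp[OF es] by auto
      then show ?thesis using True by simp
    next
      case False
      then have "opt_max_load V es \<le> 2 * k"
        using supp(1)[OF es] by (intro opt_le_of_not_heavy) (auto simp: bad_def I_def)
      then have "real (opt_max_load V es) \<le> real (2 * k)" by (simp only: of_nat_le_iff)
      then show ?thesis using False by simp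
    qed
  qed (auto simp: indicator_def)
  also have "\<dots> = 2 * real k + real n * measure_pmf.prob ?M bad"
    by (subst Bochner_Integration.integral_add) auto
  also have "\<dots> \<le> 2 * real k + real n * (real (b + 1) * real (r * b) * \<delta>)"
    using bad by (intro add_left_mono mult_left_mono) auto
  finally show ?thesis .
qed

section \<open>Numerical estimates\<close>

text \<open>The tail \<open>(exp (-2) * \<mu> / b) ^ (K * m)\<close> has to beat the number of
  choices of \<open>A\<close> and \<open>B\<close>. The factor \<open>exp (-2) ^ K\<close> absorbs
  the arity \<open>r\<close>, and the powers of \<open>\<mu> / b\<close> absorb the two factors
  \<open>b / m\<close> from the binomials.\<close>

lemma heavy_prob_le:
  assumes n: "n \<le> b ^ 2" and K: "27 \<le> K" "exp 3 * real r \<le> exp (2 * real K)"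
    and b: "real b ^ 9 \<le> exp (sqrt (real b))" and m: "1 \<le> m"
  shows "measure_pmf.prob (iid_arrivals E n) (heavy K c m) \<le> 1 / real b ^ 9"
proof -
  define \<mu> where "\<mu> = min m b"
  have bm: "0 < real b" "0 < real m" "0 < real K" using b_pos m K by auto
  \<comment> \<open>The constant 27 comes from \<open>e \<le> 3\<close>, that is
    \<open>exp 3 \<le> 27 \<le> K\<close>.\<close>
  have "exp 1 \<le> exp (-2) * real K"
  proof -
    have "exp 1 ^ 3 \<le> (3::real) ^ 3" using exp_le by (intro power_mono) auto
    then have "exp 3 \<le> (27::real)" by (simp add: exp_of_nat_mult[symmetric])
    then have "exp (-2) * exp 3 \<le> exp (-2) * real K" using K(1) by (intro mult_left_mono) auto
    then show ?thesis by (simp add: exp_add[symmetric])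
  qed
  then have eK: "exp 1 / real K \<le> exp (-2)" using bm by (simp add: field_simps)
  let ?tail = "real (n choose (K * m)) * (real (m * \<mu>) / real b ^ 3) ^ (K * m)"
  have tail: "?tail \<le> (exp (-2) * (real \<mu> / real b)) ^ (K * m)"
  proof -
    have "?tail \<le> (exp 1 * real n / real (K * m)) ^ (K * m) * (real (m * \<mu>) / real b ^ 3) ^ (K * m)"
      using bm by (intro mult_right_mono binomial_le_exp_pow) auto
    also have "\<dots> = (exp 1 / real K * (real n / real b ^ 2 * (real \<mu> / real b))) ^ (K * m)"
    proof -
      have "exp 1 * real n / real (K * m) * (real (m * \<mu>) / real b ^ 3)
          = exp 1 / real K * (real n / real b ^ 2 * (real \<mu> / real b))"
        using bm by (simp add: power2_eq_square power3_eq_cube)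
      then show ?thesis
        by (simp only: power_mult_distrib[symmetric])
    qed
    also have "\<dots> \<le> (exp (-2) * (1 * (real \<mu> / real b))) ^ (K * m)"
    proof (intro power_mono mult_mono eK)
      have "real n \<le> real (b ^ 2)" using n by (simp only: of_nat_le_iff)
      then show "real n / real b ^ 2 \<le> 1" using bm by simp
    qed auto
    finally show ?thesis by simp
  qed
  have choose_A: "real (r * b choose m) \<le> (exp 1 * real r * (real b / real m)) ^ m"
    using binomial_le_exp_pow[of m "r * b"] m by (simp add: mult.assoc)
  have exp_m: "exp (- 1) ^ m \<le> 1 / real b ^ 9" if "sqrt (real b) \<le> real m"
  proof -
    have "real b ^ 9 \<le> exp (real m)"
      using b that by (meson exp_le_cancel_iff order_trans)
    then show ?thesis
      using bm by (simp flip: exp_of_nat_mult add: exp_minus field_simps)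
  qed
  have rK: "exp 2 * real r * exp (-2) ^ K \<le> exp (-1)"
  proof -
    have "exp 2 * real r * exp (-2) ^ K = exp (-1) * ((exp 3 * real r) * exp (- (2 * real K)))"
      by (simp flip: exp_of_nat_mult exp_add add: algebra_simps)
    also have "\<dots> \<le> exp (-1) * (exp (2 * real K) * exp (- (2 * real K)))"
      using K(2) by (intro mult_left_mono mult_right_mono) auto
    finally show ?thesis by (simp flip: exp_add)
  qed
  have "measure_pmf.prob (iid_arrivals E n) (heavy K c m)
      \<le> real (r * b choose m) * real (b choose \<mu>) * ?tail"
    using heavy_prob[of n K c m] by (simp add: \<mu>_def)
  also have "\<dots> \<le> real (r * b choose m) * real (b choose \<mu>) * (exp (-2) * (real \<mu> / real b)) ^ (K * m)"
    using tail by (intro mult_left_mono) auto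
  also have "\<dots> \<le> 1 / real b ^ 9"
  proof (cases "m \<le> b")
    case True
    define x where "x = real m / real b"
    have x: "0 < x" "x \<le> 1" using True bm by (auto simp: x_def)
    have \<mu>: "\<mu> = m" using True by (simp add: \<mu>_def)
    have "real (r * b choose m) * real (b choose \<mu>) * (exp (-2) * (real \<mu> / real b)) ^ (K * m)
        \<le> (exp 1 * real r * (real b / real m)) ^ m * (exp 1 * (real b / real m)) ^ m * (exp (-2) * x) ^ (K * m)"
      unfolding \<mu> x_def using choose_A binomial_le_exp_pow[of m b] m
      by (intro mult_right_mono mult_mono) auto
    also have "\<dots> = (exp 2 * real r * exp (-2) ^ K * (x ^ K / x ^ 2)) ^ m"
    proof -
      have "exp 2 = exp 1 * exp (1::real)" by (simp flip: exp_add)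
      moreover have "real b / real m = 1 / x" by (simp add: x_def)
      ultimately show ?thesis
        by (simp only: power_mult power_mult_distrib[symmetric])
          (simp add: power2_eq_square power_mult_distrib power_divide mult_ac)
    qed
    also have "x ^ K / x ^ 2 = x ^ (K - 2)"
      using K(1) x by (subst power_diff) auto
    also have "(exp 2 * real r * exp (-2) ^ K * x ^ (K - 2)) ^ m \<le> (exp (-1) * x ^ 18) ^ m"
      using rK K(1) x by (intro power_mono mult_mono power_decreasing) auto
    also have "\<dots> \<le> 1 / real b ^ 9"
    \<comment> \<open>For large \<open>m\<close> the factor \<open>exp (-1) ^ m\<close> suffices.
      For small \<open>m\<close> one has \<open>x ^ 2 \<le> 1 / b\<close>, and a single factor
      \<open>x ^ 18\<close> gives the ninth power.\<close>
    proof (cases "sqrt (real b) \<le> real m")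
      case True
      have "(exp (-1) * x ^ 18) ^ m \<le> (exp (-1) * 1) ^ m"
        using x by (intro power_mono mult_left_mono power_le_one) auto
      also have "\<dots> \<le> 1 / real b ^ 9"
        using exp_m[OF True] by simp
      finally show ?thesis .
    next
      case False
      then have "real m ^ 2 \<le> sqrt (real b) ^ 2"
        by (intro power_mono) auto
      then have "x ^ 2 \<le> 1 / real b"
        using bm by (simp add: x_def power_divide field_simps power2_eq_square)
      then have "(x ^ 2) ^ 9 \<le> (1 / real b) ^ 9"
        by (intro power_mono) auto
      then have x18: "x ^ 18 \<le> 1 / real b ^ 9"
        by (simp add: power_divide flip: power_mult)
      have "exp (-1) * x ^ 18 \<le> 1 * x ^ 18"
        using x by (intro mult_right_mono) auto
      moreover have "x ^ 18 \<le> 1" using x by (intro power_le_one) auto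
      ultimately have "exp (-1) * x ^ 18 \<le> 1" by linarith
      then have "(exp (-1) * x ^ 18) ^ m \<le> (exp (-1) * x ^ 18) ^ 1"
        using m x by (intro power_decreasing) auto
      also have "\<dots> \<le> 1 / real b ^ 9"
        using \<open>exp (-1) * x ^ 18 \<le> 1 * x ^ 18\<close> x18 by simp
      finally show ?thesis .
    qed
    finally show ?thesis .
  next
    case False
    \<comment> \<open>The parent side is now the whole cluster, so \<open>b choose \<mu>\<close> and
      \<open>\<mu> / b\<close> are both 1.\<close>
    then have \<mu>: "\<mu> = b" by (simp add: \<mu>_def)
    have "real (r * b choose m) * real (b choose \<mu>) * (exp (-2) * (real \<mu> / real b)) ^ (K * m)
        \<le> (exp 1 * real r * (real b / real m)) ^ m * exp (-2) ^ (K * m)"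
      unfolding \<mu> using choose_A bm by (simp add: mult_right_mono)
    also have "\<dots> = (exp 1 * real r * (real b / real m) * exp (-2) ^ K) ^ m"
      by (simp only: power_mult power_mult_distrib[symmetric])
    also have "\<dots> \<le> (exp (-1)) ^ m"
    proof (rule power_mono)
      have "exp 1 * real r * (real b / real m) * exp (-2) ^ K \<le> exp 2 * real r * 1 * exp (-2) ^ K"
        using False bm by (intro mult_mono) auto
      then show "exp 1 * real r * (real b / real m) * exp (-2) ^ K \<le> exp (-1)"
        using rK by simp
    qed simp
    also have "\<dots> \<le> 1 / real b ^ 9"
    proof (rule exp_m)
      have "sqrt (real b) \<le> sqrt (real b ^ 2)"
        using b_pos by (intro real_sqrt_le_mono self_le_power) auto
      also have "\<dots> \<le> real m" using False by simp
      finally show "sqrt (real b) \<le> real m" .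
    qed
    finally show ?thesis .
  qed
  finally show ?thesis .
qed

text \<open>The exponent 9 leaves room: \<open>n * (b + 1) * (r * b)\<close> is at most
  \<open>2 * b ^ 5\<close>, so the exceptional event contributes at most
  \<open>2 / b ^ 4\<close>.\<close>

lemma OPT_le_linear:
  assumes n: "n \<le> b ^ 2" and r: "r \<le> b" and k: "27 \<le> k" "exp 3 * real r \<le> exp (2 * real k)"
    and b: "real b ^ 9 \<le> exp (sqrt (real b))"
  shows "OPT V E n \<le> 2 * real k + 2"
proof -
  have b1: "1 \<le> real b" using b_pos by simp
  have "exp (2 * real k) \<le> exp (2 * real (Suc k))" by simp
  with k(2) have "exp 3 * real r \<le> exp (2 * real (Suc k))" by linarith
  then have "OPT V E n \<le> 2 * real k + real n * (real (b + 1) * real (r * b) * (1 / real b ^ 9))"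
    using n k(1) b by (intro OPT_le heavy_prob_le) auto
  also have "real n * (real (b + 1) * real (r * b) * (1 / real b ^ 9))
      \<le> real (b ^ 2) * (real (2 * b) * real (b * b) * (1 / real b ^ 9))"
    using n r b_pos by (intro mult_mono mult_nonneg_nonneg of_nat_mono) auto
  also have "\<dots> = 2 / real b ^ 4"
    using b_pos by (simp add: field_simps power_numeral_reduce)
  also have "\<dots> \<le> 2"
    using divide_left_mono[OF one_le_power[OF b1, of 4], of 2] b_pos by simp
  finally show ?thesis by simp
qed

text \<open>A window has at least \<open>n / (2 * L)\<close> arrivals. The constant 80 makes the
  exponent of the contraction at least \<open>5 * l\<close>, of which
  \<open>2 ^ L \<le> exp l\<close> uses up one \<open>l\<close>.\<close>

lemma greedy_failure_le:
  assumes L: "1 \<le> L" "2 * L \<le> n" "real L \<le> l" and b: "real b ^ 2 \<le> 2 * real n"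
    and r: "80 * l ^ 2 \<le> real r" "r \<le> b"
  shows "real L * (real ((b + 1) * b) * (2 ^ L * (1 - real r / real b ^ 2 / 4) ^ (n div L)))
           \<le> l * (real ((b + 1) * b) * exp (- 4 * l))"
proof -
  have l: "1 \<le> l" using L by linarith
  have b0: "0 < real b" using b_pos by simp
  have "real r / real b ^ 2 \<le> 1"
  proof -
    have "r * 1 \<le> b * b" using r(2) b_pos by (intro mult_mono) auto
    then have "real (r * 1) \<le> real (b * b)" by (simp only: of_nat_le_iff)
    then show ?thesis using b_pos by (simp add: power2_eq_square)
  qed
  then have base: "0 \<le> 1 - real r / real b ^ 2 / 4" by simp
  have "n < L * (n div L) + L"
    using dividend_less_times_div[of L n] L(1) by simp
  moreover have "L * 1 \<le> L * (n div L)"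
    using L by (intro mult_le_mono2) (simp add: Suc_le_eq div_greater_zero_iff)
  ultimately have "n \<le> 2 * (L * (n div L))" by linarith
  then have "real n \<le> real (2 * (L * (n div L)))" by (simp only: of_nat_le_iff)
  then have w: "real n / (2 * real L) \<le> real (n div L)"
    using L(1) by (simp add: field_simps)
  have "5 * l \<le> 80 * l ^ 2 / (2 * real n) / 4 * (real n / (2 * real L))"
    using L l by (simp add: field_simps power2_eq_square)
  also have "\<dots> \<le> real r / real b ^ 2 / 4 * real (n div L)"
    using L l b b0 r w by (intro mult_mono divide_right_mono frac_le) auto
  finally have rate: "5 * l \<le> real r / real b ^ 2 / 4 * real (n div L)" .
  have "(1 - real r / real b ^ 2 / 4) ^ (n div L) \<le> exp (- (real r / real b ^ 2 / 4)) ^ (n div L)"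
    using base exp_ge_add_one_self[of "- (real r / real b ^ 2 / 4)"] by (intro power_mono) auto
  also have "\<dots> = exp (- (real r / real b ^ 2 / 4 * real (n div L)))"
    by (simp flip: exp_of_nat_mult add: mult.commute)
  also have "\<dots> \<le> exp (- 5 * l)" using rate by simp
  finally have 1: "(1 - real r / real b ^ 2 / 4) ^ (n div L) \<le> exp (- 5 * l)" .
  have "(2::real) ^ L \<le> exp 1 ^ L"
    using exp_ge_add_one_self[of 1] by (intro power_mono) auto
  also have "\<dots> \<le> exp l"
    using L by (simp flip: exp_of_nat_mult)
  finally have "2 ^ L * (1 - real r / real b ^ 2 / 4) ^ (n div L) \<le> exp l * exp (- 5 * l)"
    using 1 base by (intro mult_mono) auto
  also have "\<dots> = exp (- 4 * l)" by (simp flip: exp_add)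
  finally have "2 ^ L * (1 - real r / real b ^ 2 / 4) ^ (n div L) \<le> exp (- 4 * l)" .
  then show ?thesis
    using L l base by (intro mult_mono mult_left_mono mult_nonneg_nonneg) auto
qed

end

section \<open>Choice of the parameters\<close>

definition blowup_size :: "nat \<Rightarrow> nat" where
  "blowup_size n = nat \<lceil>sqrt (real n)\<rceil>"

definition heap_arity :: "nat \<Rightarrow> nat" where
  "heap_arity n = 80 * nat \<lceil>ln (real n)\<rceil> ^ 2"

text \<open>The 6 makes the tree fit: as \<open>r + 1 \<le> ln n ^ 3\<close> for large
  \<open>n\<close>, \<open>(r + 1) ^ L\<close> is at most
  \<open>exp (3 * L * ln (ln n)) \<le> sqrt n\<close>.\<close>

definition heap_depth :: "nat \<Rightarrow> nat" where
  "heap_depth n = nat \<lfloor>ln (real n) / (6 * ln (ln (real n)))\<rfloor>"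

text \<open>The double logarithm is doubled so that \<open>exp (2 * k)\<close> is at least
  \<open>exp 54 * ln n ^ 4\<close>, which exceeds \<open>exp 3\<close> times the arity for large
  \<open>n\<close>.\<close>

definition core_degree :: "nat \<Rightarrow> nat" where
  "core_degree n = 27 + nat \<lceil>2 * ln (ln (real n))\<rceil>"

lemma blowup_size_bounds:
  "sqrt (real n) \<le> real (blowup_size n)" "real (blowup_size n) \<le> sqrt (real n) + 1"
proof -
  have "0 \<le> \<lceil>sqrt (real n)\<rceil>" by (rule order_trans[of _ "\<lceil>0::real\<rceil>"]) (simp, rule ceiling_mono, simp)
  then show "sqrt (real n) \<le> real (blowup_size n)" "real (blowup_size n) \<le> sqrt (real n) + 1"
    unfolding blowup_size_def by linarith+
qed

lemma le_blowup_size_sq: "n \<le> blowup_size n ^ 2"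
proof -
  have "sqrt (real n) ^ 2 \<le> real (blowup_size n) ^ 2"
    by (intro power_mono blowup_size_bounds) simp
  then have "real n \<le> real (blowup_size n ^ 2)" by simp
  then show ?thesis by (simp only: of_nat_le_iff)
qed

lemma heap_arity_bounds:
  assumes "1 \<le> ln (real n)"
  shows "80 * ln (real n) ^ 2 \<le> real (heap_arity n)"
    "real (heap_arity n) \<le> 80 * (ln (real n) + 1) ^ 2"
proof -
  let ?l = "nat \<lceil>ln (real n)\<rceil>"
  have l: "ln (real n) \<le> real ?l" "real ?l \<le> ln (real n) + 1"
    using assms by linarith+
  have "ln (real n) ^ 2 \<le> real ?l ^ 2" "real ?l ^ 2 \<le> (ln (real n) + 1) ^ 2"
    using l assms by (auto intro!: power_mono)
  then show "80 * ln (real n) ^ 2 \<le> real (heap_arity n)"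
    "real (heap_arity n) \<le> 80 * (ln (real n) + 1) ^ 2"
    by (simp_all add: heap_arity_def)
qed

lemma heap_depth_bounds:
  assumes "0 \<le> ln (real n) / (6 * ln (ln (real n)))"
  shows "real (heap_depth n) \<le> ln (real n) / (6 * ln (ln (real n)))"
    "ln (real n) / (6 * ln (ln (real n))) - 1 \<le> real (heap_depth n)"
  unfolding heap_depth_def using assms by linarith+

lemma core_degree_bounds:
  assumes "0 \<le> ln (ln (real n))"
  shows "27 + 2 * ln (ln (real n)) \<le> real (core_degree n)"
    "real (core_degree n) \<le> 28 + 2 * ln (ln (real n))"
  unfolding core_degree_def using assms by linarith+

text \<open>All asymptotic facts are gathered here, in the order of the assumptions of the context
  below, which works at one fixed \<open>n\<close>.\<close>

lemma eventually_real_inequalities: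
  "\<forall>\<^sub>F n in sequentially.
     1 \<le> ln (real n) \<and> 1 \<le> ln (ln (real n)) \<and>
     (80 * (ln (real n) + 1) ^ 2 + 1) * (sqrt (real n) + 1) \<le> sqrt (real n) * ln (real n) ^ 3 \<and>
     80 * (ln (real n) + 1) ^ 2 + 1 \<le> ln (real n) ^ 3 \<and>
     80 * (ln (real n) + 1) ^ 2 \<le> sqrt (real n) \<and>
     (sqrt (real n) + 1) ^ 9 \<le> exp (sqrt (sqrt (real n))) \<and>
     (sqrt (real n) + 1) ^ 2 \<le> 2 * real n \<and>
     (sqrt (real n) + 2) * (sqrt (real n) + 1) \<le> 2 * real n \<and>
     2 * ln (real n) \<le> real n \<and>
     2 \<le> ln (real n) / (6 * ln (ln (real n))) \<and>
     exp 3 * (80 * (ln (real n) + 1) ^ 2) \<le> ln (real n) ^ 4 * exp 54"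
  by (intro eventually_conj; real_asymp)

context
  fixes n :: nat
  assumes ln1: "1 \<le> ln (real n)" and lnln1: "1 \<le> ln (ln (real n))"
    and deg: "(80 * (ln (real n) + 1) ^ 2 + 1) * (sqrt (real n) + 1) \<le> sqrt (real n) * ln (real n) ^ 3"
    and ar3: "80 * (ln (real n) + 1) ^ 2 + 1 \<le> ln (real n) ^ 3"
    and ar: "80 * (ln (real n) + 1) ^ 2 \<le> sqrt (real n)"
    and ex: "(sqrt (real n) + 1) ^ 9 \<le> exp (sqrt (sqrt (real n)))"
    and sq: "(sqrt (real n) + 1) ^ 2 \<le> 2 * real n"
    and sz: "(sqrt (real n) + 2) * (sqrt (real n) + 1) \<le> 2 * real n"
    and lnn: "2 * ln (real n) \<le> real n"
    and dep: "2 \<le> ln (real n) / (6 * ln (ln (real n)))"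
    and cr: "exp 3 * (80 * (ln (real n) + 1) ^ 2) \<le> ln (real n) ^ 4 * exp 54"
begin

lemma n_pos: "0 < n"
  using ln1 by (cases n) auto

lemma blowup_locale: "heap_blowup (blowup_size n) (heap_arity n)"
proof
  have "0 < sqrt (real n)" using n_pos by simp
  then show "0 < blowup_size n"
    using blowup_size_bounds(1)[of n] by (metis of_nat_0_less_iff order_less_le_trans)
  have "0 < 80 * ln (real n) ^ 2" using ln1 by simp
  then show "0 < heap_arity n"
    using heap_arity_bounds(1)[OF ln1] by (metis of_nat_0_less_iff order_less_le_trans)
qed

interpretation heap_blowup "blowup_size n" "heap_arity n"
  by (rule blowup_locale)

lemma degree_bounds:
  assumes "v \<in> V"
  shows "sqrt (real n) \<le> real (vertex_degree E v)"
    "real (vertex_degree E v) \<le> sqrt (real n) * ln (real n) ^ 3"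
proof -
  have "real (blowup_size n) \<le> real (vertex_degree E v)"
    using vertex_degree_ge[OF assms] by simp
  with blowup_size_bounds(1) show "sqrt (real n) \<le> real (vertex_degree E v)"
    by (rule order_trans)
  have "real (vertex_degree E v) \<le> real ((heap_arity n + 1) * blowup_size n)"
    using vertex_degree_le by (simp only: of_nat_le_iff)
  also have "\<dots> = (real (heap_arity n) + 1) * real (blowup_size n)"
    by (simp add: algebra_simps)
  also have "\<dots> \<le> (80 * (ln (real n) + 1) ^ 2 + 1) * (sqrt (real n) + 1)"
    using blowup_size_bounds(2)[of n] heap_arity_bounds(2)[OF ln1] by (intro mult_mono) auto
  also note deg
  finally show "real (vertex_degree E v) \<le> sqrt (real n) * ln (real n) ^ 3" .
qed

lemma card_V_bounds: "real n \<le> real (card V)" "real (card V) \<le> 2 * real n"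
proof -
  have card: "card V = (blowup_size n + 1) * blowup_size n"
    by (simp add: V_def)
  have "n \<le> card V"
    using le_blowup_size_sq[of n] unfolding card by (simp add: power2_eq_square)
  then show "real n \<le> real (card V)" by simp
  have "real (card V) = (real (blowup_size n) + 1) * real (blowup_size n)"
    unfolding card by (simp add: algebra_simps)
  also have "\<dots> \<le> (sqrt (real n) + 2) * (sqrt (real n) + 1)"
    using blowup_size_bounds(2)[of n] by (intro mult_mono) auto
  also note sz
  finally show "real (card V) \<le> 2 * real n" .
qed

lemma arity_le_size: "heap_arity n \<le> blowup_size n"
proof -
  have "real (heap_arity n) \<le> real (blowup_size n)"
    using heap_arity_bounds(2)[OF ln1] ar blowup_size_bounds(1)[of n] by linarith
  then show ?thesis by simp
qed

lemma OPT_bound: "OPT V E n \<le> 62 * ln (ln (real n))"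
proof -
  have exp_lnln: "exp (ln (ln (real n))) = ln (real n)"
    using ln1 by (intro exp_ln) simp
  have "exp 3 * real (heap_arity n) \<le> exp 3 * (80 * (ln (real n) + 1) ^ 2)"
    using heap_arity_bounds(2)[OF ln1] by (intro mult_left_mono) auto
  also have "\<dots> \<le> ln (real n) ^ 4 * exp 54" by (rule cr)
  also have "\<dots> = exp (4 * ln (ln (real n)) + 54)"
    using exp_of_nat_mult[of 4 "ln (ln (real n))"] by (simp add: exp_add exp_lnln)
  also have "\<dots> \<le> exp (2 * real (core_degree n))"
    using core_degree_bounds(1)[of n] lnln1 by simp
  finally have "exp 3 * real (heap_arity n) \<le> exp (2 * real (core_degree n))" .
  moreover have "real (blowup_size n) ^ 9 \<le> exp (sqrt (real (blowup_size n)))"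
  proof -
    have "real (blowup_size n) ^ 9 \<le> (sqrt (real n) + 1) ^ 9"
      using blowup_size_bounds(2) by (intro power_mono) auto
    also have "\<dots> \<le> exp (sqrt (sqrt (real n)))" by (rule ex)
    also have "\<dots> \<le> exp (sqrt (real (blowup_size n)))"
      using blowup_size_bounds(1) by simp
    finally show ?thesis .
  qed
  ultimately have "OPT V E n \<le> 2 * real (core_degree n) + 2"
    using le_blowup_size_sq arity_le_size by (intro OPT_le_linear) (auto simp: core_degree_def)
  \<comment> \<open>The bound is \<open>2 * (28 + 2 * ln (ln n)) + 2\<close>, and its constant part
    58 is absorbed using \<open>ln (ln n) \<ge> 1\<close>.\<close>
  also have "\<dots> \<le> 62 * ln (ln (real n))"
    using core_degree_bounds(2)[of n] lnln1 by linarith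
  finally show ?thesis .
qed

lemma greedy_bound:
  "1 - ln (real n) * (2 * real n * exp (- 4 * ln (real n)))
     \<le> measure_pmf.prob (greedy_max_load V E n)
         {m. 1 / 12 * (ln (real n) / ln (ln (real n))) \<le> real m}"
proof -
  have exp_lnln: "exp (ln (ln (real n))) = ln (real n)"
    using ln1 by (intro exp_ln) simp
  note depth = heap_depth_bounds[OF order_trans[OF zero_le_numeral dep]]
  have L1: "1 \<le> real (heap_depth n)"
    using depth(2) dep by linarith
  have "1 < ln (real n)"
    using ln_gt_zero_iff[of "ln (real n)"] ln1 lnln1 by linarith
  then have "ln (real n) / (6 * ln (ln (real n))) \<le> ln (real n) / 1"
    using ln1 lnln1 by (intro divide_left_mono) auto
  with depth(1) have Ll: "real (heap_depth n) \<le> ln (real n)" by simp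
  have "real ((heap_arity n + 1) ^ heap_depth n) \<le> (ln (real n) ^ 3) ^ heap_depth n"
    unfolding of_nat_power using heap_arity_bounds(2)[OF ln1] ar3 by (intro power_mono) auto
  also have "\<dots> = exp (3 * ln (ln (real n))) ^ heap_depth n"
    using exp_of_nat_mult[of 3 "ln (ln (real n))"] by (simp add: exp_lnln)
  also have "\<dots> = exp (real (heap_depth n) * (3 * ln (ln (real n))))"
    by (rule exp_of_nat_mult[symmetric])
  also have "\<dots> \<le> exp (ln (real n) / 2)"
  proof -
    have "real (heap_depth n) * (3 * ln (ln (real n)))
        \<le> ln (real n) / (6 * ln (ln (real n))) * (3 * ln (ln (real n)))"
      using depth(1) lnln1 by (intro mult_right_mono) auto
    also have "\<dots> = ln (real n) / 2" using lnln1 by simp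
    finally show ?thesis by simp
  qed
  also have "\<dots> = sqrt (real n)"
    using n_pos by (simp add: ln_sqrt[symmetric])
  also have "\<dots> \<le> real (blowup_size n)" by (rule blowup_size_bounds)
  finally have depth_fits: "(heap_arity n + 1) ^ heap_depth n \<le> blowup_size n"
    by (simp only: of_nat_le_iff)
  have "real (blowup_size n) ^ 2 \<le> (sqrt (real n) + 1) ^ 2"
    using blowup_size_bounds(2) by (intro power_mono) auto
  with sq have b2: "real (blowup_size n) ^ 2 \<le> 2 * real n" by linarith
  have "real (2 * heap_depth n) \<le> real n" using Ll lnn by simp
  then have L2: "2 * heap_depth n \<le> n" by (simp only: of_nat_le_iff)
  let ?\<delta> = "real (heap_depth n) * (real ((blowup_size n + 1) * blowup_size n) * (2 ^ heap_depth n *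
      (1 - real (heap_arity n) / real (blowup_size n) ^ 2 / 4) ^ (n div heap_depth n)))"
  have "?\<delta> \<le> ln (real n) * (real ((blowup_size n + 1) * blowup_size n) * exp (- 4 * ln (real n)))"
    using L1 L2 Ll b2 heap_arity_bounds(1)[OF ln1] arity_le_size by (intro greedy_failure_le) auto
  also have "\<dots> \<le> ln (real n) * (2 * real n * exp (- 4 * ln (real n)))"
    using card_V_bounds(2) ln1 by (intro mult_left_mono mult_right_mono) (auto simp: V_def)
  finally have "1 - ln (real n) * (2 * real n * exp (- 4 * ln (real n))) \<le> 1 - ?\<delta>" by simp
  also have "\<dots> \<le> measure_pmf.prob (greedy_max_load V E n) {m. heap_depth n \<le> m}"
    by (rule greedy_max_load_prob[OF depth_fits arity_le_size])
  also have "\<dots> \<le> measure_pmf.prob (greedy_max_load V E n)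
      {m. 1 / 12 * (ln (real n) / ln (ln (real n))) \<le> real m}"
  proof (rule measure_pmf.finite_measure_mono)
    \<comment> \<open>Rounding down loses at most 1, which is at most half of the unrounded depth
      since that is at least 2; this turns 1/6 into 1/12.\<close>
    have "1 / 12 * (ln (real n) / ln (ln (real n))) \<le> real (heap_depth n)"
      using depth(2) dep by simp
    then show "{m. heap_depth n \<le> m} \<subseteq> {m. 1 / 12 * (ln (real n) / ln (ln (real n))) \<le> real m}"
      by auto
  qed simp
  finally show ?thesis .
qed

end

section \<open>Assembling the asymptotic statement\<close>

theorem theorem1p2:
  shows "\<exists>(V :: nat \<Rightarrow> nat set) (E :: nat \<Rightarrow> nat set set).
    (\<forall>\<^sub>F n in sequentially. simple_graph (V n) (E n) \<and>
        (\<forall>v \<in> V n. sqrt (real n) \<le> real (vertex_degree (E n) v) \<and>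
                     real (vertex_degree (E n) v) \<le> sqrt (real n) * ln (real n) ^ 3)) \<and>
    (\<lambda>n. real (card (V n))) \<in> \<Theta>(\<lambda>n. real n) \<and>
    (\<exists>c :: real. c > 0 \<and> (\<lambda>n. measure_pmf.prob (greedy_max_load (V n) (E n) n)
                    {m. real m \<ge> c * (ln (real n) / ln (ln (real n)))}) \<longlonglongrightarrow> 1) \<and>
    (\<lambda>n. OPT (V n) (E n) n) \<in> O(\<lambda>n. ln (ln (real n)))"
proof -
  define V where "V = (\<lambda>n. heap_blowup.V (blowup_size n))"
  define E where "E = (\<lambda>n. heap_blowup.E (blowup_size n) (heap_arity n))"
  have ev: "\<forall>\<^sub>F n in sequentially.
      (simple_graph (V n) (E n) \<and>
        (\<forall>v \<in> V n. sqrt (real n) \<le> real (vertex_degree (E n) v) \<and>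
                     real (vertex_degree (E n) v) \<le> sqrt (real n) * ln (real n) ^ 3)) \<and>
      (real n \<le> real (card (V n)) \<and> real (card (V n)) \<le> 2 * real n) \<and>
      1 - ln (real n) * (2 * real n * exp (- 4 * ln (real n)))
        \<le> measure_pmf.prob (greedy_max_load (V n) (E n) n)
            {m. 1 / 12 * (ln (real n) / ln (ln (real n))) \<le> real m} \<and>
      OPT (V n) (E n) n \<le> 62 * ln (ln (real n)) \<and> 0 \<le> ln (ln (real n))"
    using eventually_real_inequalities
  proof (rule eventually_mono, elim conjE, goal_cases)
    case (1 n)
    note ineqs = 1(2-)
    show ?case
      unfolding V_def E_def
      using heap_blowup.simple_graph[OF blowup_locale[OF ineqs]] degree_bounds[OF ineqs] card_V_bounds[OF ineqs]
        greedy_bound[OF ineqs] OPT_bound[OF ineqs] ineqs(2)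
      by auto
  qed
  \<comment> \<open>The bound in \<open>O\<close> is on absolute values, so an upper bound alone
    does not suffice.\<close>
  have OPT_nonneg: "0 \<le> OPT (V n) (E n) n" for n
    unfolding OPT_def by (rule Bochner_Integration.integral_nonneg) simp
  have "(\<lambda>n. real (card (V n))) \<in> \<Theta>(\<lambda>n. real n)"
  proof (rule bigthetaI)
    show "(\<lambda>n. real (card (V n))) \<in> O(\<lambda>n. real n)"
      by (rule bigoI[of _ 2]) (use ev in eventually_elim, auto)
    show "(\<lambda>n. real (card (V n))) \<in> \<Omega>(\<lambda>n. real n)"
      by (rule landau_omega.bigI[of 1]) (simp, use ev in eventually_elim, auto)
  qed
  moreover have "(\<lambda>n. OPT (V n) (E n) n) \<in> O(\<lambda>n. ln (ln (real n)))"
    by (rule bigoI[of _ 62]) (use ev in eventually_elim, use OPT_nonneg in auto)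
  moreover have "(\<lambda>n. measure_pmf.prob (greedy_max_load (V n) (E n) n)
      {m. real m \<ge> 1 / 12 * (ln (real n) / ln (ln (real n)))}) \<longlonglongrightarrow> 1"
  proof (rule tendsto_sandwich)
    \<comment> \<open>The failure probability is at most \<open>2 * ln n / n ^ 3\<close>.\<close>
    show "(\<lambda>n. 1 - ln (real n) * (2 * real n * exp (- 4 * ln (real n)))) \<longlonglongrightarrow> 1"
      by real_asymp
    show "\<forall>\<^sub>F n in sequentially. 1 - ln (real n) * (2 * real n * exp (- 4 * ln (real n)))
        \<le> measure_pmf.prob (greedy_max_load (V n) (E n) n)
            {m. real m \<ge> 1 / 12 * (ln (real n) / ln (ln (real n)))}"
      using ev by eventually_elim blast
    show "\<forall>\<^sub>F n in sequentially. measure_pmf.prob (greedy_max_load (V n) (E n) n)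
        {m. real m \<ge> 1 / 12 * (ln (real n) / ln (ln (real n)))} \<le> 1"
      by simp
  qed simp
  then have "\<exists>c::real. c > 0 \<and> (\<lambda>n. measure_pmf.prob (greedy_max_load (V n) (E n) n)
      {m. real m \<ge> c * (ln (real n) / ln (ln (real n)))}) \<longlonglongrightarrow> 1"
    by (intro exI[of _ "1 / 12"]) simp
  moreover have "\<forall>\<^sub>F n in sequentially. simple_graph (V n) (E n) \<and>
      (\<forall>v \<in> V n. sqrt (real n) \<le> real (vertex_degree (E n) v) \<and>
                   real (vertex_degree (E n) v) \<le> sqrt (real n) * ln (real n) ^ 3)"
    using ev by eventually_elim blast
  ultimately show ?thesis by blast
qed

end
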